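(* Let $n$ be a prime number, let $p_1,p_2,p_3,p_4\in\mathbb{Z}^{+}$, let $P_3^4=(p_1,p_2,-p_3,-p_4)$ be an oriented pretzel link, and let $\mathbb{Z}_n$ be the dihedral quandle. Put $h=-p_1p_2p_3-p_1p_2p_4+p_1p_3p_4+p_2p_3p_4$. Then, with all congruences modulo $n$, $$|\mathrm{Hom}(\mathcal{Q}(P_3^4),\mathbb{Z}_n)|=\begin{cases} n & \text{if } h\not\equiv 0;\\ n^2 & \text{if } h\equiv 0 \text{ and } p_ip_j\not\equiv 0 \text{ for at least one pair } i\neq j,\ i,j\in\{1,2,3,4\};\\ n^3 & \text{if exactly one of } p_1,p_2,p_3,p_4 \text{ is coprime with } n;\\ n^4 & \text{if } p_1\equiv p_2\equiv p_3\equiv p_4\equiv 0.\end{cases}$$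
   Context: A quandle is a set $X$ with a binary operation $\triangleright$ such that $x\triangleright x=x$ for all $x$; for each $y$ the map $x\mapsto x\triangleright y$ is invertible; and $(x\triangleright y)\triangleright z=(x\triangleright z)\triangleright(y\triangleright z)$ for all $x,y,z$. A quandle homomorphism $f$ satisfies $f(x\triangleright y)=f(x)\triangleright f(y)$. The dihedral quandle $\mathbb{Z}_n$ is the set of integers modulo $n$ with $x\triangleright y=2y-x \pmod n$. For an oriented link $K$ with diagram $D$, the fundamental quandle $\mathcal{Q}(K)$ is the quandle generated by the arcs of $D$ with one relation per crossing: if the overcrossing arc is $y$ (pointing up), and $x$ is the undercrossing arc on the right of $y$, then the undercrossing arc on the left of $y$ is $x\triangleright y$. $\mathrm{Hom}(\mathcal{Q}(K),X)$ is the set of quandle homomorphisms (colorings of $K$ by $X$); its cardinality is the coloring number of $K$ (with respect to $X$). Pretzel link: for nonzero integers $p_1,\dots,p_m$, the pretzel link $(p_1,\dots,p_m)$ (an $m$-pretzel link) is formed from $m$ tangles $A_1,\dots,A_m$ placed side by side, where $A_i$ is a vertical column of two strands twisted about each other with $|p_i|$ crossings, all of one fixed handedness if $p_i>0$ ("positive") and all of the opposite handedness if $p_i<0$ ("negative"). The NE endpoint of $A_i$ is joined to the NW endpoint of $A_{i+1}$, the SE endpoint of $A_i$ to the SW endpoint of $A_{i+1}$, and the outer endpoints are closed up by joining the NW (resp. SW) endpoint of $A_1$ to the NE (resp. SE) endpoint of $A_m$. Any orientation of the link may be chosen. *)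

theory Defs
  imports "HOL-Library.FuncSet" "HOL-Number_Theory.Cong" "HOL-Computational_Algebra.Primes"
begin

section \<open>Quandles\<close>

record 'a qnd =
  qcarrier :: "'a set"
  qop :: "'a \<Rightarrow> 'a \<Rightarrow> 'a"  (infixl "\<rhd>\<index>" 70)

locale quandle =
  fixes X :: "('a, 'more) qnd_scheme" (structure)
  assumes closed: "x \<in> qcarrier X \<Longrightarrow> y \<in> qcarrier X \<Longrightarrow> x \<rhd> y \<in> qcarrier X"
    and idem: "x \<in> qcarrier X \<Longrightarrow> x \<rhd> x = x"
    and invertible: "y \<in> qcarrier X \<Longrightarrow> bij_betw (\<lambda>x. x \<rhd> y) (qcarrier X) (qcarrier X)"
    and self_distrib: "x \<in> qcarrier X \<Longrightarrow> y \<in> qcarrier X \<Longrightarrow> z \<in> qcarrier X \<Longrightarrow>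
      (x \<rhd> y) \<rhd> z = (x \<rhd> z) \<rhd> (y \<rhd> z)"

text \<open>Homomorphisms are taken extensional, so that each is counted exactly once.\<close>

definition quandle_hom :: "('a, 'm) qnd_scheme \<Rightarrow> ('b, 'k) qnd_scheme \<Rightarrow> ('a \<Rightarrow> 'b) set" where
  "quandle_hom Q X = {f \<in> qcarrier Q \<rightarrow>\<^sub>E qcarrier X.
     \<forall>x\<in>qcarrier Q. \<forall>y\<in>qcarrier Q. f (x \<rhd>\<^bsub>Q\<^esub> y) = f x \<rhd>\<^bsub>X\<^esub> f y}"

definition dihedral_quandle :: "nat \<Rightarrow> int qnd" where
  "dihedral_quandle n = \<lparr>qcarrier = {0..<int n}, qop = (\<lambda>x y. (2 * y - x) mod int n)\<rparr>"

lemma quandle_dihedral: "quandle (dihedral_quandle n)"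
proof
  fix x y z
  assume y: "y \<in> qcarrier (dihedral_quandle n)"
  have fin: "finite {0..<int n}" by simp
  have inj: "inj_on (\<lambda>x. (2 * y - x) mod int n) {0..<int n}"
  proof (rule inj_onI)
    fix a b assume ab: "a \<in> {0..<int n}" "b \<in> {0..<int n}"
      and "(2 * y - a) mod int n = (2 * y - b) mod int n"
    then have "(2 * y - (2 * y - a)) mod int n = (2 * y - (2 * y - b)) mod int n"
      by (metis mod_diff_right_eq)
    with ab show "a = b" by simp
  qed
  have "(\<lambda>x. (2 * y - x) mod int n) ` {0..<int n} \<subseteq> {0..<int n}"
    using y by (auto simp: dihedral_quandle_def)
  then have "bij_betw (\<lambda>x. (2 * y - x) mod int n) {0..<int n} {0..<int n}"
    using endo_inj_surj[OF fin _ inj] inj unfolding bij_betw_def by blast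
  then show "bij_betw (\<lambda>x. x \<rhd>\<^bsub>dihedral_quandle n\<^esub> y)
      (qcarrier (dihedral_quandle n)) (qcarrier (dihedral_quandle n))"
    by (simp only: dihedral_quandle_def qnd.simps)
  show "(x \<rhd>\<^bsub>dihedral_quandle n\<^esub> y) \<rhd>\<^bsub>dihedral_quandle n\<^esub> z =
      (x \<rhd>\<^bsub>dihedral_quandle n\<^esub> z) \<rhd>\<^bsub>dihedral_quandle n\<^esub> (y \<rhd>\<^bsub>dihedral_quandle n\<^esub> z)"
  proof -
    have "int n dvd ((2 * z - a) - (2 * b - c))"
      if "a = (2 * y - x) mod int n" "b = (2 * z - y) mod int n" "c = (2 * z - x) mod int n" for a b c
    proof -
      have "int n dvd a - (2 * y - x)" "int n dvd b - (2 * z - y)" "int n dvd c - (2 * z - x)"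
        using that by (simp_all flip: mod_eq_dvd_iff)
      then have "int n dvd c - (2 * z - x) - (a - (2 * y - x)) - 2 * (b - (2 * z - y))"
        by (meson dvd_diff dvd_mult)
      then show ?thesis by (simp add: algebra_simps)
    qed
    from this[OF HOL.refl HOL.refl HOL.refl] show ?thesis
      by (simp only: dihedral_quandle_def qnd.simps mod_eq_dvd_iff)
  qed
qed (auto simp: dihedral_quandle_def)

section \<open>Quandles presented by generators and relations\<close>

text \<open>\<open>QInv s t\<close> stands for the preimage of \<open>s\<close> under the right translation by \<open>t\<close>.\<close>

datatype 'a qterm = QGen 'a | QOp "'a qterm" "'a qterm" | QInv "'a qterm" "'a qterm"

definition qterms :: "'a set \<Rightarrow> 'a qterm set" where
  "qterms A = {t. set_qterm t \<subseteq> A}"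

inductive_set qcong :: "'a set \<Rightarrow> ('a qterm \<times> 'a qterm) set \<Rightarrow> ('a qterm \<times> 'a qterm) set"
  for A R where
  rel: "(s, t) \<in> R \<Longrightarrow> s \<in> qterms A \<Longrightarrow> t \<in> qterms A \<Longrightarrow> (s, t) \<in> qcong A R"
| refl: "t \<in> qterms A \<Longrightarrow> (t, t) \<in> qcong A R"
| sym: "(s, t) \<in> qcong A R \<Longrightarrow> (t, s) \<in> qcong A R"
| trans: "(s, t) \<in> qcong A R \<Longrightarrow> (t, u) \<in> qcong A R \<Longrightarrow> (s, u) \<in> qcong A R"
| op_cong: "(s, s') \<in> qcong A R \<Longrightarrow> (t, t') \<in> qcong A R \<Longrightarrow>
    (QOp s t, QOp s' t') \<in> qcong A R"
| inv_cong: "(s, s') \<in> qcong A R \<Longrightarrow> (t, t') \<in> qcong A R \<Longrightarrow>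
    (QInv s t, QInv s' t') \<in> qcong A R"
| idem: "t \<in> qterms A \<Longrightarrow> (QOp t t, t) \<in> qcong A R"
| op_inv: "s \<in> qterms A \<Longrightarrow> t \<in> qterms A \<Longrightarrow> (QOp (QInv s t) t, s) \<in> qcong A R"
| inv_op: "s \<in> qterms A \<Longrightarrow> t \<in> qterms A \<Longrightarrow> (QInv (QOp s t) t, s) \<in> qcong A R"
| distrib: "s \<in> qterms A \<Longrightarrow> t \<in> qterms A \<Longrightarrow> u \<in> qterms A \<Longrightarrow>
    (QOp (QOp s t) u, QOp (QOp s u) (QOp t u)) \<in> qcong A R"

definition presented_quandle ::
    "'a set \<Rightarrow> ('a qterm \<times> 'a qterm) set \<Rightarrow> 'a qterm set qnd" where
  "presented_quandle A R =
    \<lparr>qcarrier = qterms A // qcong A R,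
     qop = (\<lambda>P Q. \<Union>s\<in>P. \<Union>t\<in>Q. qcong A R `` {QOp s t})\<rparr>"

lemma qcong_qterms:
  "(s, t) \<in> qcong A R \<Longrightarrow> s \<in> qterms A \<and> t \<in> qterms A"
  by (induction rule: qcong.induct) (auto simp: qterms_def)

lemma equiv_qcong: "equiv (qterms A) (qcong A R)"
proof (rule equivI)
  show "qcong A R \<subseteq> qterms A \<times> qterms A" by (auto dest: qcong_qterms)
  show "refl_on (qterms A) (qcong A R)" by (auto simp: refl_on_def intro: qcong.refl)
  show "sym (qcong A R)" by (blast intro: symI qcong.sym)
  show "trans (qcong A R)" by (blast intro: transI qcong.trans)
qed

lemma presented_qop:
  assumes "s \<in> qterms A" "t \<in> qterms A"
  shows "qcong A R `` {s} \<rhd>\<^bsub>presented_quandle A R\<^esub> qcong A R `` {t} = qcong A R `` {QOp s t}"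
proof -
  have "qcong A R `` {QOp s' t'} = qcong A R `` {QOp s t}"
    if "(s, s') \<in> qcong A R" "(t, t') \<in> qcong A R" for s' t'
    using equiv_class_eq[OF equiv_qcong qcong.op_cong[OF that]] by simp
  moreover have "(s, s) \<in> qcong A R" "(t, t) \<in> qcong A R"
    using assms by (auto intro: qcong.refl)
  ultimately have "(\<Union>s'\<in>qcong A R `` {s}. \<Union>t'\<in>qcong A R `` {t}. qcong A R `` {QOp s' t'}) =
      qcong A R `` {QOp s t}"
    by blast
  then show ?thesis by (simp add: presented_quandle_def)
qed

lemma quandle_presented: "quandle (presented_quandle A R)"
proof -
  let ?X = "presented_quandle A R"
  let ?c = "\<lambda>t. qcong A R `` {t}"
  have car: "qcarrier ?X = ?c ` qterms A"
    by (auto simp: presented_quandle_def quotient_def)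
  have eq: "?c s = ?c t" if "(s, t) \<in> qcong A R" for s t
    using that by (rule equiv_class_eq[OF equiv_qcong])
  have op [simp]: "QOp s t \<in> qterms A" and inv [simp]: "QInv s t \<in> qterms A"
    if "s \<in> qterms A" "t \<in> qterms A" for s t
    using that by (auto simp: qterms_def)
  show ?thesis
  proof
    fix y assume "y \<in> qcarrier ?X"
    then obtain t where t: "t \<in> qterms A" "y = ?c t" by (auto simp: car)
    show "bij_betw (\<lambda>x. x \<rhd>\<^bsub>?X\<^esub> y) (qcarrier ?X) (qcarrier ?X)"
      unfolding bij_betw_def
    proof
      show "inj_on (\<lambda>x. x \<rhd>\<^bsub>?X\<^esub> y) (qcarrier ?X)"
      proof (rule inj_onI)
        fix a b assume "a \<in> qcarrier ?X" "b \<in> qcarrier ?X" and e: "a \<rhd>\<^bsub>?X\<^esub> y = b \<rhd>\<^bsub>?X\<^esub> y"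
        then obtain r s where rs: "r \<in> qterms A" "a = ?c r" "s \<in> qterms A" "b = ?c s"
          by (auto simp: car)
        with e t have "?c (QOp r t) = ?c (QOp s t)" by (simp add: presented_qop)
        then have "(QOp r t, QOp s t) \<in> qcong A R"
          using rs t by (simp add: eq_equiv_class_iff[OF equiv_qcong])
        then have "(QInv (QOp r t) t, QInv (QOp s t) t) \<in> qcong A R"
          using t by (blast intro: qcong.inv_cong qcong.refl)
        with rs t have "(r, s) \<in> qcong A R"
          by (meson qcong.inv_op qcong.sym qcong.trans)
        with rs show "a = b" by (simp add: eq)
      qed
      show "(\<lambda>x. x \<rhd>\<^bsub>?X\<^esub> y) ` qcarrier ?X = qcarrier ?X"
      proof
        show "(\<lambda>x. x \<rhd>\<^bsub>?X\<^esub> y) ` qcarrier ?X \<subseteq> qcarrier ?X"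
          using t by (auto simp: car presented_qop)
        show "qcarrier ?X \<subseteq> (\<lambda>x. x \<rhd>\<^bsub>?X\<^esub> y) ` qcarrier ?X"
        proof
          fix a assume "a \<in> qcarrier ?X"
          then obtain s where s: "s \<in> qterms A" "a = ?c s" by (auto simp: car)
          have "a = ?c (QInv s t) \<rhd>\<^bsub>?X\<^esub> y"
            using s t by (simp add: presented_qop eq[OF qcong.op_inv])
          with s t show "a \<in> (\<lambda>x. x \<rhd>\<^bsub>?X\<^esub> y) ` qcarrier ?X"
            by (auto simp: car)
        qed
      qed
    qed
  next
    fix x y z assume "x \<in> qcarrier ?X" "y \<in> qcarrier ?X" "z \<in> qcarrier ?X"
    then obtain r s t where rst: "r \<in> qterms A" "s \<in> qterms A" "t \<in> qterms A"
      and xyz: "x = ?c r" "y = ?c s" "z = ?c t"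
      by (auto simp: car)
    have "?c (QOp (QOp r s) t) = ?c (QOp (QOp r t) (QOp s t))"
      using rst by (intro eq qcong.distrib)
    with rst show "(x \<rhd>\<^bsub>?X\<^esub> y) \<rhd>\<^bsub>?X\<^esub> z = (x \<rhd>\<^bsub>?X\<^esub> z) \<rhd>\<^bsub>?X\<^esub> (y \<rhd>\<^bsub>?X\<^esub> z)"
      unfolding xyz by (simp only: presented_qop op)
  next
    fix x y assume "x \<in> qcarrier ?X" "y \<in> qcarrier ?X"
    then obtain r s where "r \<in> qterms A" "s \<in> qterms A" "x = ?c r" "y = ?c s"
      by (auto simp: car)
    then show "x \<rhd>\<^bsub>?X\<^esub> y \<in> qcarrier ?X"
      by (simp add: car presented_qop)
  next
    fix x assume "x \<in> qcarrier ?X"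
    then obtain r where "r \<in> qterms A" "x = ?c r"
      by (auto simp: car)
    then show "x \<rhd>\<^bsub>?X\<^esub> x = x"
      by (simp add: presented_qop eq[OF qcong.idem])
  qed
qed

section \<open>Oriented link diagrams\<close>

text \<open>
  Each crossing is drawn as the letter X and has four ends, named after the corners of the letter.
  Opposite ends belong to the same strand.  The set \<open>over D x\<close> consists of the two ends of
  the overcrossing strand, and \<open>glue D\<close> sends each end to the end at the other side of the edge
  of the diagram that leaves the crossing there.
\<close>

datatype corner = NW | NE | SE | SW

fun clockwise :: "corner \<Rightarrow> corner" where
  "clockwise NW = NE" | "clockwise NE = SE" | "clockwise SE = SW" | "clockwise SW = NW"

definition opposite :: "corner \<Rightarrow> corner" where
  "opposite c = clockwise (clockwise c)"

record 'c diagram =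
  crossings :: "'c set"
  over :: "'c \<Rightarrow> corner set"
  glue :: "'c \<times> corner \<Rightarrow> 'c \<times> corner"

definition ends :: "'c diagram \<Rightarrow> ('c \<times> corner) set" where
  "ends D = crossings D \<times> UNIV"

definition link_diagram :: "'c diagram \<Rightarrow> bool" where
  "link_diagram D \<longleftrightarrow> finite (crossings D) \<and>
     (\<forall>x\<in>crossings D. over D x = {NW, SE} \<or> over D x = {NE, SW}) \<and>
     (\<forall>e\<in>ends D. glue D e \<in> ends D \<and> glue D e \<noteq> e \<and> glue D (glue D e) = e)"

text \<open>
  An orientation is given by the set of ends at which a strand points away from its crossing:
  every strand through a crossing enters at one end and leaves at the opposite one, and every edge
  leaves one crossing end and enters the other.
\<close>

definition orientation :: "'c diagram \<Rightarrow> ('c \<times> corner) set \<Rightarrow> bool" where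
  "orientation D out \<longleftrightarrow> out \<subseteq> ends D \<and>
     (\<forall>(x, c)\<in>ends D. (x, c) \<in> out \<longleftrightarrow> (x, opposite c) \<notin> out) \<and>
     (\<forall>e\<in>ends D. e \<in> out \<longleftrightarrow> glue D e \<notin> out)"

text \<open>
  An arc runs along edges and over crossings, and stops where it passes under.  It is
  represented by the set of ends it contains.
\<close>

definition arc_step :: "'c diagram \<Rightarrow> (('c \<times> corner) \<times> ('c \<times> corner)) set" where
  "arc_step D = {(e, glue D e) | e. e \<in> ends D} \<union>
     {((x, c), (x, opposite c)) | x c. x \<in> crossings D \<and> c \<in> over D x}"

definition arc_of :: "'c diagram \<Rightarrow> 'c \<times> corner \<Rightarrow> ('c \<times> corner) set" where
  "arc_of D e = (arc_step D \<union> (arc_step D)\<inverse>)\<^sup>* `` {e}"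

definition arcs :: "'c diagram \<Rightarrow> ('c \<times> corner) set set" where
  "arcs D = arc_of D ` ends D"

text \<open>
  If the overcrossing strand leaves \<open>x\<close> at the end \<open>c\<close>, then turning the picture so that
  this strand points up puts the end clockwise from \<open>c\<close> on its right and the end opposite
  to that one on its left.
\<close>

definition crossing_relations ::
    "'c diagram \<Rightarrow> ('c \<times> corner) set \<Rightarrow>
      (('c \<times> corner) set qterm \<times> ('c \<times> corner) set qterm) set" where
  "crossing_relations D out =
    {(QOp (QGen (arc_of D (x, clockwise c))) (QGen (arc_of D (x, c))),
      QGen (arc_of D (x, opposite (clockwise c)))) | x c.
      x \<in> crossings D \<and> c \<in> over D x \<and> (x, c) \<in> out}"

definition fundamental_quandle ::
    "'c diagram \<Rightarrow> ('c \<times> corner) set \<Rightarrow> ('c \<times> corner) set qterm set qnd" where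
  "fundamental_quandle D out = presented_quandle (arcs D) (crossing_relations D out)"

section \<open>Pretzel links\<close>

text \<open>
  Columns are numbered from left to right and the crossings \<open>(i, k)\<close> of column \<open>i\<close> from top to
  bottom, both starting from 0.  A column has constant handedness when the same diagonal is over
  at all of its crossings.  Which handedness is called positive is a matter of convention, and is
  left as the parameter \<open>pos\<close>: the diagonal of the overcrossing strand in a positive column.
\<close>

datatype diagonal = NW_SE | NE_SW

fun diagonal_ends :: "diagonal \<Rightarrow> corner set" where
  "diagonal_ends NW_SE = {NW, SE}" | "diagonal_ends NE_SW = {NE, SW}"

fun other_diagonal :: "diagonal \<Rightarrow> diagonal" where
  "other_diagonal NW_SE = NE_SW" | "other_diagonal NE_SW = NW_SE"

fun pretzel_glue :: "int list \<Rightarrow> (nat \<times> nat) \<times> corner \<Rightarrow> (nat \<times> nat) \<times> corner" where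
  "pretzel_glue ps ((i, k), c) =
    (let m = length ps; r = (i + 1) mod m; l = (i + m - 1) mod m; len = (\<lambda>j. nat \<bar>ps ! j\<bar>) in
     case c of
       NW \<Rightarrow> if k = 0 then ((l, 0), NE) else ((i, k - 1), SW)
     | NE \<Rightarrow> if k = 0 then ((r, 0), NW) else ((i, k - 1), SE)
     | SW \<Rightarrow> if k + 1 = len i then ((l, len l - 1), SE) else ((i, k + 1), NW)
     | SE \<Rightarrow> if k + 1 = len i then ((r, len r - 1), SW) else ((i, k + 1), NE))"

definition pretzel :: "diagonal \<Rightarrow> int list \<Rightarrow> (nat \<times> nat) diagram" where
  "pretzel pos ps =
    \<lparr>crossings = {(i, k). i < length ps \<and> k < nat \<bar>ps ! i\<bar>},
     over = (\<lambda>(i, k). diagonal_ends (if ps ! i > 0 then pos else other_diagonal pos)),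
     glue = pretzel_glue ps\<rparr>"

lemma link_diagram_pretzel:
  assumes nonzero: "\<forall>a\<in>set ps. a \<noteq> 0"
  shows "link_diagram (pretzel pos ps)"
proof -
  let ?m = "length ps"
  have "crossings (pretzel pos ps) = (SIGMA i:{..<?m}. {..<nat \<bar>ps ! i\<bar>})"
    by (auto simp: pretzel_def)
  then have fin: "finite (crossings (pretzel pos ps))" by simp
  have ov: "over (pretzel pos ps) x = {NW, SE} \<or> over (pretzel pos ps) x = {NE, SW}" for x
    by (cases pos) (auto simp: pretzel_def split: prod.split)
  have gl: "glue (pretzel pos ps) e \<in> ends (pretzel pos ps) \<and> glue (pretzel pos ps) e \<noteq> e \<and>
      glue (pretzel pos ps) (glue (pretzel pos ps) e) = e"
    if e: "e \<in> ends (pretzel pos ps)" for e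
  proof -
    obtain i k c where ikc: "e = ((i, k), c)" by (metis prod.collapse)
    with e have i: "i < ?m" and k: "k < nat \<bar>ps ! i\<bar>"
      by (auto simp: ends_def pretzel_def)
    have len: "j < ?m \<Longrightarrow> 0 < nat \<bar>ps ! j\<bar>" for j using nonzero by simp
    define nx where "nx = (\<lambda>j. (j + 1) mod ?m)"
    define pv where "pv = (\<lambda>j. (j + ?m - 1) mod ?m)"
    define h where "h = (\<lambda>j. nat \<bar>ps ! j\<bar>)"
    have r: "nx i < ?m" and l: "pv i < ?m"
      unfolding nx_def pv_def using i by (metis gr_implies_not0 mod_less_divisor neq0_conv)+
    have rl: "pv (nx i) = i"
    proof (cases "i + 1 = ?m")
      case True then show ?thesis using i by (simp add: nx_def pv_def flip: True)
    next
      case False then show ?thesis using i by (simp add: nx_def pv_def)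
    qed
    have lr: "nx (pv i) = i"
      using i by (cases i) (simp_all add: nx_def pv_def)
    have g: "glue (pretzel pos ps) ((j, k'), c) =
      (case c of
         NW \<Rightarrow> if k' = 0 then ((pv j, 0), NE) else ((j, k' - 1), SW)
       | NE \<Rightarrow> if k' = 0 then ((nx j, 0), NW) else ((j, k' - 1), SE)
       | SW \<Rightarrow> if k' + 1 = h j then ((pv j, h (pv j) - 1), SE) else ((j, k' + 1), NW)
       | SE \<Rightarrow> if k' + 1 = h j then ((nx j, h (nx j) - 1), SW) else ((j, k' + 1), NE))"
      for j k' c
      by (cases c) (simp_all add: Let_def nx_def pv_def h_def pretzel_def)
    have E: "((j, k'), c) \<in> ends (pretzel pos ps) \<longleftrightarrow> j < ?m \<and> k' < h j" for j k' c
      by (simp add: ends_def pretzel_def h_def)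
    have h: "0 < h (nx i)" "0 < h (pv i)" "k < h i"
      using len[OF r] len[OF l] k by (simp_all add: h_def)
    show ?thesis
      using i h r l by (cases c) (auto simp: ikc g E rl lr)
  qed
  show ?thesis unfolding link_diagram_def using fin ov gl by blast
qed

end

theory Submission
  imports Defs
begin

text \<open>
  A homomorphism from a presented quandle is a choice of images of the generators that respects the
  relations (\<open>bij_betw_quandle_hom_presented\<close>).  For a link diagram and the dihedral quandle \<open>\<int>\<^sub>n\<close>,
  this means coloring the arcs by residues so that, at every crossing, the two undercrossing colors
  add up to twice the overcrossing color.  This condition is symmetric in the two sides, so the
  orientation of the link drops out, and what remains to be counted are the Fox colorings of the
  diagram (\<open>card_quandle_hom_dihedral\<close>).

  In a column of a pretzel diagram, let \<open>d\<close> be the color of the right strand minus the color of the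
  left strand at the top.  A crossing adds \<open>d\<close> to both colors or subtracts it from both, depending on
  which diagonal is over; in particular it preserves \<open>d\<close>.  Hence a coloring is determined by the color
  \<open>a\<close> of the upper left corner and the differences \<open>d\<^sub>i\<close> of the columns.  The closure of the top
  row requires \<open>\<Sum>\<^sub>i d\<^sub>i = 0\<close>.  A column with \<open>q\<^sub>i\<close> signed crossings shifts its colors by
  \<open>\<plusminus>q\<^sub>i d\<^sub>i\<close>, with the same sign for all columns, so the closures between adjacent columns at the
  bottom require that all the products \<open>q\<^sub>i d\<^sub>i\<close> agree.  No other condition arises
  (\<open>card_fox_colorings_pretzel\<close>), and \<open>a\<close> contributes a factor \<open>n\<close>.

  For prime \<open>n\<close> this is a linear system over a field.  If some \<open>q\<^sub>i\<close> vanish, the common value of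
  \<open>q\<^sub>i d\<^sub>i\<close> is 0, so \<open>d\<^sub>i = 0\<close> wherever \<open>q\<^sub>i \<noteq> 0\<close>, and the remaining \<open>d\<^sub>i\<close> are free apart from
  having sum 0.  If no \<open>q\<^sub>i\<close> vanishes, then \<open>d\<^sub>i\<close> is a common multiple \<open>c\<close> of
  \<open>\<Prod>\<^sub>j\<^sub>\<noteq>\<^sub>i q\<^sub>j\<close>, and the sum condition says \<open>c E = 0\<close>, where \<open>E\<close> is the sum of these products.  Thus the
  number of colorings is \<open>n\<close> to the number of vanishing \<open>q\<^sub>i\<close> in the first case, and \<open>n\<^sup>2\<close> or \<open>n\<close>
  in the second, according to whether \<open>E\<close> vanishes (\<open>pretzel_dihedral_coloring_number\<close>).  For the
  columns \<open>p\<^sub>1, p\<^sub>2, -p\<^sub>3, -p\<^sub>4\<close>, the number \<open>E\<close> is \<open>h\<close>.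
\<close>

section \<open>Homomorphisms from presented quandles\<close>

primrec qterm_eval :: "('b, 'm) qnd_scheme \<Rightarrow> ('a \<Rightarrow> 'b) \<Rightarrow> 'a qterm \<Rightarrow> 'b" where
  "qterm_eval X g (QGen a) = g a"
| "qterm_eval X g (QOp s t) = qterm_eval X g s \<rhd>\<^bsub>X\<^esub> qterm_eval X g t"
| "qterm_eval X g (QInv s t) =
     inv_into (qcarrier X) (\<lambda>x. x \<rhd>\<^bsub>X\<^esub> qterm_eval X g t) (qterm_eval X g s)"

lemma qterms_simps [simp]:
  "QGen a \<in> qterms A \<longleftrightarrow> a \<in> A"
  "QOp s t \<in> qterms A \<longleftrightarrow> s \<in> qterms A \<and> t \<in> qterms A"
  "QInv s t \<in> qterms A \<longleftrightarrow> s \<in> qterms A \<and> t \<in> qterms A"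
  by (auto simp: qterms_def)

context quandle
begin

lemma right_inverse_closed:
  assumes "x \<in> qcarrier X" "y \<in> qcarrier X"
  shows "inv_into (qcarrier X) (\<lambda>z. z \<rhd> y) x \<in> qcarrier X"
  using invertible[OF assms(2)] assms(1) by (metis bij_betw_imp_surj_on inv_into_into)

lemma op_right_inverse:
  assumes "x \<in> qcarrier X" "y \<in> qcarrier X"
  shows "inv_into (qcarrier X) (\<lambda>z. z \<rhd> y) x \<rhd> y = x"
  using bij_betw_inv_into_right[OF invertible[OF assms(2)] assms(1)] .

lemma right_inverse_op:
  assumes "x \<in> qcarrier X" "y \<in> qcarrier X"
  shows "inv_into (qcarrier X) (\<lambda>z. z \<rhd> y) (x \<rhd> y) = x"
  using bij_betw_inv_into_left[OF invertible[OF assms(2)] assms(1)] .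

lemma qterm_eval_closed:
  assumes "g \<in> A \<rightarrow> qcarrier X" "t \<in> qterms A"
  shows "qterm_eval X g t \<in> qcarrier X"
  using assms(2) by (induction t) (use assms(1) in \<open>auto intro: closed right_inverse_closed\<close>)

text \<open>
  The rules that generate the congruence are the quandle axioms, which hold in \<open>X\<close>, together with
  \<open>R\<close>, so evaluation in \<open>X\<close> is well defined on congruence classes.
\<close>

lemma qterm_eval_qcong:
  assumes g: "g \<in> A \<rightarrow> qcarrier X"
    and R: "\<And>s t. (s, t) \<in> R \<Longrightarrow> qterm_eval X g s = qterm_eval X g t"
    and st: "(s, t) \<in> qcong A R"
  shows "qterm_eval X g s = qterm_eval X g t"
  using st
proof (induction rule: qcong.induct)
  case (distrib s t u)
  then show ?case by (simp add: self_distrib qterm_eval_closed[OF g])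
qed (simp_all add: R qterm_eval_closed[OF g] idem op_right_inverse right_inverse_op)

text \<open>
  A homomorphism is only required to respect the operation \<open>\<rhd>\<close>.  It respects the formal inverse
  \<open>QInv\<close> as well, because right translations in \<open>X\<close> are injective; so it is determined by its values
  on the generators.
\<close>

lemma quandle_hom_presented_eval:
  assumes \<phi>: "\<phi> \<in> quandle_hom (presented_quandle A R) X" and t: "t \<in> qterms A"
  shows "\<phi> (qcong A R `` {t}) = qterm_eval X (\<lambda>a. \<phi> (qcong A R `` {QGen a})) t"
  using t
proof (induction t)
  case (QOp s t)
  then show ?case
    using \<phi> by (force simp: quandle_hom_def presented_quandle_def quotientI
        simp flip: presented_qop)
next
  case (QInv s t)
  let ?c = "\<lambda>t. qcong A R `` {t}"
  have car: "?c u \<in> qcarrier (presented_quandle A R)" if "u \<in> qterms A" for u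
    using that by (simp add: presented_quandle_def quotientI)
  have in_X: "\<phi> (?c u) \<in> qcarrier X" if "u \<in> qterms A" for u
    using \<phi> car[OF that] by (auto simp: quandle_hom_def)
  from QInv have st: "s \<in> qterms A" "t \<in> qterms A" by simp_all
  have "\<phi> (?c (QInv s t)) \<rhd> \<phi> (?c t) = \<phi> (?c (QInv s t) \<rhd>\<^bsub>presented_quandle A R\<^esub> ?c t)"
    using \<phi> car st by (simp add: quandle_hom_def)
  also have "\<dots> = \<phi> (?c s)"
    using st equiv_class_eq[OF equiv_qcong qcong.op_inv[OF st]] by (simp add: presented_qop)
  finally have "inv_into (qcarrier X) (\<lambda>z. z \<rhd> \<phi> (?c t)) (\<phi> (?c s)) = \<phi> (?c (QInv s t))"
    using right_inverse_op[of "\<phi> (?c (QInv s t))" "\<phi> (?c t)"] in_X st by simp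
  then show ?case using QInv.IH st by simp
qed simp

text \<open>The universal property of a presentation by generators and relations.\<close>

lemma bij_betw_quandle_hom_presented:
  assumes R: "R \<subseteq> qterms A \<times> qterms A"
  shows "bij_betw (\<lambda>\<phi>. \<lambda>a\<in>A. \<phi> (qcong A R `` {QGen a}))
    (quandle_hom (presented_quandle A R) X)
    {g \<in> A \<rightarrow>\<^sub>E qcarrier X. \<forall>(s, t)\<in>R. qterm_eval X g s = qterm_eval X g t}"
    (is "bij_betw ?res ?H ?G")
proof -
  let ?Q = "presented_quandle A R" and ?c = "\<lambda>t. qcong A R `` {t}"
  have car: "qcarrier ?Q = ?c ` qterms A"
    by (auto simp: presented_quandle_def quotient_def)
  have eval_cong: "qterm_eval X g t = qterm_eval X g' t"
    if "t \<in> qterms A" "\<And>a. a \<in> A \<Longrightarrow> g a = g' a" for g g' :: "_ \<Rightarrow> 'a" and t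
    using that(1) by (induction t) (simp_all add: that(2))
  have eval: "\<phi> (?c t) = qterm_eval X (?res \<phi>) t" if "\<phi> \<in> ?H" "t \<in> qterms A" for \<phi> t
    unfolding quandle_hom_presented_eval[OF that] by (rule eval_cong[OF that(2)]) simp
  show ?thesis
  proof (rule bij_betw_imageI)
    show "inj_on ?res ?H"
    proof (rule inj_onI)
      fix \<phi> \<psi> assume H: "\<phi> \<in> ?H" "\<psi> \<in> ?H" and eq: "?res \<phi> = ?res \<psi>"
      then have "\<phi> x = \<psi> x" if "x \<in> qcarrier ?Q" for x
        using that eval[of \<phi>] eval[of \<psi>] by (auto simp: car)
      moreover have "\<phi> \<in> extensional (qcarrier ?Q)" "\<psi> \<in> extensional (qcarrier ?Q)"
        using H by (auto simp: quandle_hom_def PiE_def)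
      ultimately show "\<phi> = \<psi>" by (intro extensionalityI)
    qed
  next
    show "?res ` ?H = ?G"
    proof (intro equalityI subsetI)
      fix g assume "g \<in> ?res ` ?H"
      then obtain \<phi> where \<phi>: "\<phi> \<in> ?H" "g = ?res \<phi>" by blast
      have "?c (QGen a) \<in> qcarrier ?Q" if "a \<in> A" for a
        using that by (simp add: car)
      then have "g \<in> A \<rightarrow>\<^sub>E qcarrier X"
        using \<phi> by (auto simp: quandle_hom_def)
      moreover have "qterm_eval X g s = qterm_eval X g t" if "(s, t) \<in> R" for s t
      proof -
        have "s \<in> qterms A" "t \<in> qterms A" using R that by auto
        then have "?c s = ?c t"
          using that by (intro equiv_class_eq[OF equiv_qcong] qcong.rel)
        then show ?thesis
          using eval[OF \<phi>(1)] \<open>s \<in> qterms A\<close> \<open>t \<in> qterms A\<close> \<phi>(2) by metis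
      qed
      ultimately show "g \<in> ?G" by blast
    next
      fix g assume "g \<in> ?G"
      then have gE: "g \<in> A \<rightarrow>\<^sub>E qcarrier X"
        and gR: "\<And>s t. (s, t) \<in> R \<Longrightarrow> qterm_eval X g s = qterm_eval X g t" by auto
      have g: "g \<in> A \<rightarrow> qcarrier X" using gE by auto
      define \<phi> where "\<phi> = (\<lambda>P\<in>qcarrier ?Q. qterm_eval X g (SOME t. t \<in> P))"
      have \<phi>_class: "\<phi> (?c t) = qterm_eval X g t" if t: "t \<in> qterms A" for t
      proof -
        have "t \<in> ?c t" using t by (simp add: qcong.refl)
        then have "(SOME t'. t' \<in> ?c t) \<in> ?c t" by (rule someI)
        then have "(t, SOME t'. t' \<in> ?c t) \<in> qcong A R" by simp
        from qterm_eval_qcong[OF g gR this] show ?thesis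
          using t by (simp add: \<phi>_def car)
      qed
      have "\<phi> \<in> ?H"
        using qterm_eval_closed[OF g]
        by (auto simp: quandle_hom_def car \<phi>_class presented_qop simp del: PiE_iff
            intro!: PiE_I) (auto simp: \<phi>_def car)
      moreover have "?res \<phi> = g"
        using gE by (auto simp: \<phi>_class fun_eq_iff PiE_def extensional_def)
      ultimately show "g \<in> ?res ` ?H" by blast
    qed
  qed
qed

end

section \<open>Colorings of link diagrams by dihedral quandles\<close>

text \<open>
  Colors are assigned to the ends of crossings rather than to arcs, so that every condition concerns
  a single edge or a single crossing, and the arcs need not be traced through the diagram.
\<close>

definition fox_colorings :: "nat \<Rightarrow> 'c diagram \<Rightarrow> ('c \<times> corner \<Rightarrow> int) set" where
  "fox_colorings n D = {f \<in> ends D \<rightarrow>\<^sub>E {0..<int n}.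
     (\<forall>e\<in>ends D. f (glue D e) = f e) \<and>
     (\<forall>x\<in>crossings D. \<forall>c\<in>over D x. f (x, opposite c) = f (x, c) \<and>
        [f (x, clockwise c) + f (x, opposite (clockwise c)) = 2 * f (x, c)] (mod int n))}"

lemma opposite_simps [simp]:
  "opposite NW = SE" "opposite NE = SW" "opposite SE = NW" "opposite SW = NE"
  by (simp_all add: opposite_def)

lemma arc_of_eq_iff: "arc_of D e = arc_of D e' \<longleftrightarrow> (e, e') \<in> (arc_step D \<union> (arc_step D)\<inverse>)\<^sup>*"
proof -
  have "sym ((arc_step D \<union> (arc_step D)\<inverse>)\<^sup>*)"
    by (intro sym_rtrancl sym_Un_converse)
  then show ?thesis
    unfolding arc_of_def by (auto dest: symD intro: rtrancl_trans)
qed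

lemma arc_of_glue:
  assumes "e \<in> ends D"
  shows "arc_of D (glue D e) = arc_of D e"
proof -
  have "(e, glue D e) \<in> arc_step D" using assms unfolding arc_step_def by blast
  then show ?thesis unfolding arc_of_eq_iff by blast
qed

lemma arc_of_over:
  assumes "x \<in> crossings D" "c \<in> over D x"
  shows "arc_of D (x, opposite c) = arc_of D (x, c)"
proof -
  have "((x, c), (x, opposite c)) \<in> arc_step D" using assms unfolding arc_step_def by blast
  then show ?thesis unfolding arc_of_eq_iff by blast
qed

lemma constant_on_arc:
  assumes "\<And>e. e \<in> ends D \<Longrightarrow> f (glue D e) = f e"
    and "\<And>x c. x \<in> crossings D \<Longrightarrow> c \<in> over D x \<Longrightarrow> f (x, opposite c) = f (x, c)"
    and "arc_of D e = arc_of D e'"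
  shows "f e = f e'"
proof -
  have step: "f a = f b" if "(a, b) \<in> arc_step D" for a b
    using that assms(1,2) by (auto simp: arc_step_def)
  have "(e, e') \<in> (arc_step D \<union> (arc_step D)\<inverse>)\<^sup>*"
    using assms(3) by (simp only: arc_of_eq_iff)
  then show ?thesis
    by (induction rule: rtrancl_induct) (auto dest: step)
qed

text \<open>
  Arcs are the classes of ends generated by the two kinds of steps, and \<open>f\<close> is invariant under both;
  so its value at any representative of an arc can serve as the color of the arc.
\<close>

lemma coloring_factors_through_arcs:
  assumes fE: "f \<in> ends D \<rightarrow>\<^sub>E C"
    and f_glue: "\<And>e. e \<in> ends D \<Longrightarrow> f (glue D e) = f e"
    and f_over: "\<And>x c. x \<in> crossings D \<Longrightarrow> c \<in> over D x \<Longrightarrow> f (x, opposite c) = f (x, c)"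
  obtains g where "g \<in> arcs D \<rightarrow>\<^sub>E C" and "\<And>e. e \<in> ends D \<Longrightarrow> g (arc_of D e) = f e"
proof
  define s where "s a = (SOME e. e \<in> ends D \<and> arc_of D e = a)" for a
  let ?g = "\<lambda>a\<in>arcs D. f (s a)"
  show g_arc: "?g (arc_of D e) = f e" if e: "e \<in> ends D" for e
  proof -
    have "s (arc_of D e) \<in> ends D \<and> arc_of D (s (arc_of D e)) = arc_of D e"
      unfolding s_def by (rule someI[of _ e]) (simp add: e)
    then have "arc_of D (s (arc_of D e)) = arc_of D e" by (rule conjunct2)
    with f_glue f_over have "f (s (arc_of D e)) = f e" by (rule constant_on_arc)
    moreover have "arc_of D e \<in> arcs D" using e by (simp add: arcs_def)
    ultimately show ?thesis by simp
  qed
  show "?g \<in> arcs D \<rightarrow>\<^sub>E C"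
  proof (rule PiE_I)
    fix a assume "a \<in> arcs D"
    then obtain e where e: "e \<in> ends D" "a = arc_of D e" unfolding arcs_def by blast
    show "?g a \<in> C" unfolding e(2) g_arc[OF e(1)] using fE e(1) by (rule PiE_mem)
  qed simp
qed

lemma crossing_relation_dihedral:
  assumes "w \<in> {0..<int n}"
  shows "(2 * y - x) mod int n = w \<longleftrightarrow> [x + w = 2 * y] (mod int n)"
proof -
  have "(2 * y - x) mod int n = w \<longleftrightarrow> [2 * y - x = w] (mod int n)"
    using assms by (simp add: cong_def)
  also have "\<dots> \<longleftrightarrow> [x + w = 2 * y] (mod int n)"
    unfolding cong_iff_dvd_diff using dvd_minus_iff[of "int n" "2 * y - x - w"]
    by (simp add: algebra_simps)
  finally show ?thesis .
qed

lemma opposite_over: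
  assumes "S = {NW, SE} \<or> S = {NE, SW}" "c \<in> S"
  shows "opposite c \<in> S"
  using assms by (cases c) auto

text \<open>
  Reversing the overcrossing strand exchanges the two undercrossing ends, and these enter the
  dihedral relation symmetrically.  This is why the orientation does not affect the colorings.
\<close>

lemma crossing_condition_opposite:
  assumes "f (x, opposite c) = f (x, c)"
    and "[f (x, clockwise (opposite c)) + f (x, opposite (clockwise (opposite c))) =
      2 * f (x, opposite c)] (mod (n :: int))"
  shows "[f (x, clockwise c) + f (x, opposite (clockwise c)) = 2 * f (x, c)] (mod n)"
  using assms by (cases c) (simp_all add: add.commute)

text \<open>
  The presentation has one relation for each crossing, read off at the end where the overcrossing
  strand leaves.  A Fox coloring satisfies the relation at both ends of that strand, which is no
  stronger by the preceding symmetry.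
\<close>

theorem card_quandle_hom_dihedral:
  assumes D: "link_diagram D" and out: "orientation D out"
  shows "card (quandle_hom (fundamental_quandle D out) (dihedral_quandle n)) =
    card (fox_colorings n D)"
proof -
  let ?X = "dihedral_quandle n" and ?A = "arcs D" and ?R = "crossing_relations D out"
  define G where "G = {g \<in> ?A \<rightarrow>\<^sub>E qcarrier ?X. \<forall>(s, t)\<in>?R. qterm_eval ?X g s = qterm_eval ?X g t}"
  interpret X: quandle ?X by (rule quandle_dihedral)
  have arc_in: "arc_of D e \<in> ?A" if "e \<in> ends D" for e
    using that by (simp add: arcs_def)
  have ends_iff: "(x, c) \<in> ends D \<longleftrightarrow> x \<in> crossings D" for x c
    by (simp add: ends_def)
  have over_cases: "over D x = {NW, SE} \<or> over D x = {NE, SW}" if "x \<in> crossings D" for x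
    using D that by (simp add: link_diagram_def)
  have out_iff: "(x, opposite c) \<in> out \<longleftrightarrow> (x, c) \<notin> out" if "x \<in> crossings D" for x c
  proof -
    have "(x, c) \<in> ends D" using that by (simp add: ends_iff)
    moreover have "\<forall>(x, c)\<in>ends D. (x, c) \<in> out \<longleftrightarrow> (x, opposite c) \<notin> out"
      using out by (simp add: orientation_def)
    ultimately show ?thesis by blast
  qed
  have "?R \<subseteq> qterms ?A \<times> qterms ?A"
  proof
    fix r assume "r \<in> ?R"
    then obtain x c where "x \<in> crossings D"
      and r: "r = (QOp (QGen (arc_of D (x, clockwise c))) (QGen (arc_of D (x, c))),
        QGen (arc_of D (x, opposite (clockwise c))))"
      unfolding crossing_relations_def by blast
    then show "r \<in> qterms ?A \<times> qterms ?A" by (simp add: r arc_in ends_iff)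
  qed
  then have card1: "card (quandle_hom (fundamental_quandle D out) ?X) = card G"
    unfolding fundamental_quandle_def G_def
    by (rule bij_betw_same_card[OF X.bij_betw_quandle_hom_presented])
  have G_iff: "g \<in> G \<longleftrightarrow> g \<in> ?A \<rightarrow>\<^sub>E {0..<int n} \<and>
      (\<forall>x\<in>crossings D. \<forall>c\<in>over D x. (x, c) \<in> out \<longrightarrow>
        [g (arc_of D (x, clockwise c)) + g (arc_of D (x, opposite (clockwise c))) =
          2 * g (arc_of D (x, c))] (mod int n))" for g
  proof -
    have all_relations: "(\<forall>(s, t)\<in>?R. P s t) \<longleftrightarrow>
        (\<forall>x\<in>crossings D. \<forall>c\<in>over D x. (x, c) \<in> out \<longrightarrow>
          P (QOp (QGen (arc_of D (x, clockwise c))) (QGen (arc_of D (x, c))))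
            (QGen (arc_of D (x, opposite (clockwise c)))))" for P
      unfolding crossing_relations_def by blast
    have "(2 * g (arc_of D (x, c)) - g (arc_of D (x, clockwise c))) mod int n =
        g (arc_of D (x, opposite (clockwise c))) \<longleftrightarrow>
        [g (arc_of D (x, clockwise c)) + g (arc_of D (x, opposite (clockwise c))) =
          2 * g (arc_of D (x, c))] (mod int n)"
      if "g \<in> ?A \<rightarrow>\<^sub>E {0..<int n}" "x \<in> crossings D" for x c
      by (rule crossing_relation_dihedral, rule PiE_mem[OF that(1)])
         (simp add: arc_in ends_iff that(2))
    then have "g \<in> ?A \<rightarrow>\<^sub>E {0..<int n} \<Longrightarrow> ?thesis"
      unfolding G_def all_relations by (simp add: dihedral_quandle_def)
    moreover have "g \<notin> ?A \<rightarrow>\<^sub>E {0..<int n} \<Longrightarrow> ?thesis"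
      unfolding G_def by (simp add: dihedral_quandle_def)
    ultimately show ?thesis by blast
  qed
  have "bij_betw (\<lambda>g. \<lambda>e\<in>ends D. g (arc_of D e)) G (fox_colorings n D)"
  proof (rule bij_betw_imageI)
    show "inj_on (\<lambda>g. \<lambda>e\<in>ends D. g (arc_of D e)) G"
    proof (rule inj_onI)
      fix g g' assume G: "g \<in> G" "g' \<in> G"
        and eq: "(\<lambda>e\<in>ends D. g (arc_of D e)) = (\<lambda>e\<in>ends D. g' (arc_of D e))"
      have "g (arc_of D e) = g' (arc_of D e)" if "e \<in> ends D" for e
        using fun_cong[OF eq, of e] that by simp
      then have "g a = g' a" if "a \<in> ?A" for a
        using that by (auto simp: arcs_def)
      moreover have "g \<in> ?A \<rightarrow>\<^sub>E {0..<int n}" "g' \<in> ?A \<rightarrow>\<^sub>E {0..<int n}"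
        using G by (simp_all add: G_iff)
      ultimately show "g = g'" using PiE_ext by blast
    qed
    show "(\<lambda>g. \<lambda>e\<in>ends D. g (arc_of D e)) ` G = fox_colorings n D"
    proof (intro equalityI subsetI)
      fix f assume "f \<in> (\<lambda>g. \<lambda>e\<in>ends D. g (arc_of D e)) ` G"
      then obtain g where g: "g \<in> G" and f: "f = (\<lambda>e\<in>ends D. g (arc_of D e))" by blast
      have f_end: "f e = g (arc_of D e)" if "e \<in> ends D" for e
        using that by (simp add: f)
      have "glue D e \<in> ends D" if "e \<in> ends D" for e
        using D that by (simp add: link_diagram_def)
      then have 1: "f (glue D e) = f e" if "e \<in> ends D" for e
        using that by (simp add: f_end arc_of_glue)
      have 2: "f (x, opposite c) = f (x, c)" if "x \<in> crossings D" "c \<in> over D x" for x c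
        using that by (simp add: f_end ends_iff arc_of_over)
      have 3: "[f (x, clockwise c) + f (x, opposite (clockwise c)) = 2 * f (x, c)] (mod int n)"
        if x: "x \<in> crossings D" and c: "c \<in> over D x" for x c
      proof -
        have rel: "[f (x, clockwise c) + f (x, opposite (clockwise c)) = 2 * f (x, c)] (mod int n)"
          if "c \<in> over D x" "(x, c) \<in> out" for c
        proof -
          have "[g (arc_of D (x, clockwise c)) + g (arc_of D (x, opposite (clockwise c))) =
              2 * g (arc_of D (x, c))] (mod int n)"
            using g x that unfolding G_iff by blast
          then show ?thesis by (simp only: f_end ends_iff x)
        qed
        show ?thesis
        proof (cases "(x, c) \<in> out")
          case True
          show ?thesis by (rule rel[OF c True])
        next
          case False
          \<comment> \<open>The strand then leaves the crossing at the opposite end, where the relation is given.\<close>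
          have opp: "opposite c \<in> over D x"
            by (rule opposite_over[OF over_cases[OF x] c])
          have "(x, opposite c) \<in> out"
            by (rule out_iff[OF x, THEN iffD2, OF False])
          from crossing_condition_opposite[of f x c, OF 2[OF x c] rel[OF opp this]]
          show ?thesis .
        qed
      qed
      have "f \<in> ends D \<rightarrow>\<^sub>E {0..<int n}"
      proof (rule PiE_I)
        fix e assume "e \<in> ends D"
        then show "f e \<in> {0..<int n}"
          using g unfolding G_iff by (metis PiE_mem arc_in f_end)
      qed (simp add: f)
      with 1 2 3 show "f \<in> fox_colorings n D" unfolding fox_colorings_def by blast
    next
      fix f assume "f \<in> fox_colorings n D"
      then have fE: "f \<in> ends D \<rightarrow>\<^sub>E {0..<int n}"
        and f_glue: "\<And>e. e \<in> ends D \<Longrightarrow> f (glue D e) = f e"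
        and f_over: "\<And>x c. x \<in> crossings D \<Longrightarrow> c \<in> over D x \<Longrightarrow> f (x, opposite c) = f (x, c)"
        and f_rel: "\<And>x c. x \<in> crossings D \<Longrightarrow> c \<in> over D x \<Longrightarrow>
          [f (x, clockwise c) + f (x, opposite (clockwise c)) = 2 * f (x, c)] (mod int n)"
        unfolding fox_colorings_def by blast+
      obtain g where gE: "g \<in> ?A \<rightarrow>\<^sub>E {0..<int n}"
        and g_arc: "\<And>e. e \<in> ends D \<Longrightarrow> g (arc_of D e) = f e"
        using coloring_factors_through_arcs[OF fE f_glue f_over] by blast
      have rel: "[g (arc_of D (x, clockwise c)) + g (arc_of D (x, opposite (clockwise c))) =
          2 * g (arc_of D (x, c))] (mod int n)" if "x \<in> crossings D" "c \<in> over D x" for x c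
        using f_rel[OF that] that(1) by (simp only: g_arc ends_iff)
      with gE have "g \<in> G" unfolding G_iff by blast
      moreover have "(\<lambda>e\<in>ends D. g (arc_of D e)) = f"
      proof
        fix e show "(\<lambda>e\<in>ends D. g (arc_of D e)) e = f e"
          using PiE_arb[OF fE, of e] by (simp add: g_arc)
      qed
      ultimately show "f \<in> (\<lambda>g. \<lambda>e\<in>ends D. g (arc_of D e)) ` G" by blast
    qed
  qed
  with card1 show ?thesis by (simp add: bij_betw_same_card)
qed

section \<open>Colorings of pretzel diagrams\<close>

text \<open>
  These are the families of differences between the right and the left color at the tops of the
  columns that extend to a coloring of the pretzel diagram with \<open>q i\<close> signed crossings in column \<open>i\<close>.
\<close>

definition balanced_differences :: "nat \<Rightarrow> 'i set \<Rightarrow> ('i \<Rightarrow> int) \<Rightarrow> ('i \<Rightarrow> int) set" where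
  "balanced_differences n I q = {d \<in> I \<rightarrow>\<^sub>E {0..<int n}.
     [(\<Sum>i\<in>I. d i) = 0] (mod int n) \<and> (\<forall>i\<in>I. \<forall>j\<in>I. [q i * d i = q j * d j] (mod int n))}"

text \<open>
  Passing down through a crossing changes both colors of the column by the same multiple of the
  difference of its upper colors; this is the multiple.
\<close>

definition crossing_shift :: "diagonal \<Rightarrow> int" where
  "crossing_shift v = (case v of NW_SE \<Rightarrow> - 1 | NE_SW \<Rightarrow> 1)"

definition column_shift :: "diagonal \<Rightarrow> int \<Rightarrow> int" where
  "column_shift pos q = crossing_shift (if q > 0 then pos else other_diagonal pos)"

text \<open>The two ends of the overcrossing strand impose the same condition.\<close>

lemma diagonal_coloring_iff:
  "(\<forall>c\<in>diagonal_ends v. g (opposite c) = g c \<and>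
      [g (clockwise c) + g (opposite (clockwise c)) = 2 * g c] (mod m)) \<longleftrightarrow>
   (case v of NW_SE \<Rightarrow> g SE = g NW \<and> [g NE + g SW = 2 * g NW] (mod m)
     | NE_SW \<Rightarrow> g SW = g NE \<and> [g NW + g SE = 2 * g NE] (mod m))"
  by (cases v) (auto simp: add.commute)

text \<open>
  With upper colors \<open>x\<close> and \<open>y\<close>, the lower colors are \<open>2 * x - y\<close> and \<open>x\<close> if the strand from \<open>NW\<close> to
  \<open>SE\<close> is over, and \<open>y\<close> and \<open>2 * y - x\<close> otherwise: both are shifted by \<open>x - y\<close>, respectively
  \<open>y - x\<close>.  As the colors are reduced residues, equality of colors and congruence are the same.
\<close>

lemma diagonal_coloring_shift:
  assumes "g \<in> UNIV \<rightarrow> {0..<m}"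
  shows "(\<forall>c\<in>diagonal_ends v. g (opposite c) = g c \<and>
      [g (clockwise c) + g (opposite (clockwise c)) = 2 * g c] (mod m)) \<longleftrightarrow>
    [g SW = g NW + crossing_shift v * (g NE - g NW)] (mod m) \<and>
    [g SE = g NE + crossing_shift v * (g NE - g NW)] (mod m)"
proof -
  have eq: "g c = g c' \<longleftrightarrow> [g c = g c'] (mod m)" for c c'
  proof -
    have "g c \<in> {0..<m}" "g c' \<in> {0..<m}" using assms by auto
    then show ?thesis by (simp add: cong_def)
  qed
  show ?thesis
    unfolding diagonal_coloring_iff
    by (cases v) (auto simp: eq crossing_shift_def cong_iff_dvd_diff algebra_simps)
qed

text \<open>
  Reversing the handedness changes the sign of the shift, so the total shift over a column is its
  signed number of crossings times a sign that is common to all columns.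
\<close>

lemma column_shift_length:
  "column_shift pos q * int (nat \<bar>q\<bar>) =
    crossing_shift pos * q"
  by (cases pos) (simp_all add: column_shift_def crossing_shift_def)

text \<open>
  The coloring conditions, sorted into the crossings, the edges inside the columns, and the edges
  that join a column to the next one.  Each edge is considered from one of its two ends only.
\<close>

lemma fox_colorings_pretzel_iff:
  assumes m: "ps \<noteq> []" and nz: "\<forall>a\<in>set ps. a \<noteq> 0"
  shows "f \<in> fox_colorings n (pretzel pos ps) \<longleftrightarrow> f \<in> ends (pretzel pos ps) \<rightarrow>\<^sub>E {0..<int n} \<and>
    (\<forall>i<length ps. \<forall>k<nat \<bar>ps ! i\<bar>.
      [f ((i, k), SW) = f ((i, k), NW) + column_shift pos (ps ! i) *
         (f ((i, k), NE) - f ((i, k), NW))] (mod int n) \<and>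
      [f ((i, k), SE) = f ((i, k), NE) + column_shift pos (ps ! i) *
         (f ((i, k), NE) - f ((i, k), NW))] (mod int n)) \<and>
    (\<forall>i<length ps. \<forall>k. k + 1 < nat \<bar>ps ! i\<bar> \<longrightarrow>
       f ((i, k + 1), NW) = f ((i, k), SW) \<and> f ((i, k + 1), NE) = f ((i, k), SE)) \<and>
    (\<forall>i<length ps. f (((i + 1) mod length ps, 0), NW) = f ((i, 0), NE) \<and>
       f (((i + 1) mod length ps, nat \<bar>ps ! ((i + 1) mod length ps)\<bar> - 1), SW) =
         f ((i, nat \<bar>ps ! i\<bar> - 1), SE))"
    (is "_ \<longleftrightarrow> ?E \<and> ?cross \<and> ?inner \<and> ?outer")
proof (cases ?E)
  case False
  then show ?thesis by (simp add: fox_colorings_def)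
next
  case E: True
  let ?D = "pretzel pos ps" and ?m = "length ps"
  define len where "len i = nat \<bar>ps ! i\<bar>" for i
  define nx where "nx i = (i + 1) mod ?m" for i
  define pv where "pv i = (i + ?m - 1) mod ?m" for i
  have len_pos: "0 < len i" if "i < ?m" for i
    using nz that by (simp add: len_def)
  have nx: "nx i < ?m" and pv: "pv i < ?m" for i
    using m by (simp_all add: nx_def pv_def)
  have nx_pv: "nx (pv i) = i" if "i < ?m" for i
    using that by (cases i) (simp_all add: nx_def pv_def)
  have crossings: "crossings ?D = {(i, k). i < ?m \<and> k < len i}"
    by (simp add: pretzel_def len_def)
  have ends_iff: "((i, k), c) \<in> ends ?D \<longleftrightarrow> i < ?m \<and> k < len i" for i k c
    by (simp add: ends_def crossings)
  have glue: "glue ?D ((i, k), NW) = (if k = 0 then ((pv i, 0), NE) else ((i, k - 1), SW))"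
    "glue ?D ((i, k), NE) = (if k = 0 then ((nx i, 0), NW) else ((i, k - 1), SE))"
    "glue ?D ((i, k), SW) =
      (if k + 1 = len i then ((pv i, len (pv i) - 1), SE) else ((i, k + 1), NW))"
    "glue ?D ((i, k), SE) =
      (if k + 1 = len i then ((nx i, len (nx i) - 1), SW) else ((i, k + 1), NE))" for i k
    by (simp_all add: pretzel_def Let_def nx_def pv_def len_def)
  have "(\<forall>x\<in>crossings ?D. \<forall>c\<in>over ?D x. f (x, opposite c) = f (x, c) \<and>
        [f (x, clockwise c) + f (x, opposite (clockwise c)) = 2 * f (x, c)] (mod int n)) \<longleftrightarrow> ?cross"
  proof -
    have "(\<forall>c\<in>over ?D (i, k). f ((i, k), opposite c) = f ((i, k), c) \<and>
        [f ((i, k), clockwise c) + f ((i, k), opposite (clockwise c)) = 2 * f ((i, k), c)] (mod int n)) \<longleftrightarrow>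
      [f ((i, k), SW) = f ((i, k), NW) + column_shift pos (ps ! i) *
         (f ((i, k), NE) - f ((i, k), NW))] (mod int n) \<and>
      [f ((i, k), SE) = f ((i, k), NE) + column_shift pos (ps ! i) *
         (f ((i, k), NE) - f ((i, k), NW))] (mod int n)" if "i < ?m" "k < len i" for i k
    proof -
      have over: "over ?D (i, k) = diagonal_ends (if ps ! i > 0 then pos else other_diagonal pos)"
        by (simp add: pretzel_def)
      have "(\<lambda>c. f ((i, k), c)) \<in> UNIV \<rightarrow> {0..<int n}"
        using E that by (auto simp: ends_iff)
      from diagonal_coloring_shift[OF this] show ?thesis unfolding over column_shift_def .
    qed
    then show ?thesis by (auto simp: crossings len_def)
  qed
  moreover have "(\<forall>e\<in>ends ?D. f (glue ?D e) = f e) \<longleftrightarrow> ?inner \<and> ?outer"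
  proof (intro iffI conjI allI impI)
    assume *: "\<forall>e\<in>ends ?D. f (glue ?D e) = f e"
    fix i assume i: "i < ?m"
    show "f (((i + 1) mod length ps, 0), NW) = f ((i, 0), NE)"
      using bspec[OF *, of "((i, 0), NE)"] i len_pos by (simp add: ends_iff glue nx_def)
    show "f (((i + 1) mod ?m, nat \<bar>ps ! ((i + 1) mod ?m)\<bar> - 1), SW) = f ((i, nat \<bar>ps ! i\<bar> - 1), SE)"
      using bspec[OF *, of "((i, len i - 1), SE)"] i len_pos[OF i]
      by (simp add: ends_iff glue) (simp add: nx_def len_def)
    fix k assume k: "k + 1 < nat \<bar>ps ! i\<bar>"
    show "f ((i, k + 1), NW) = f ((i, k), SW)" "f ((i, k + 1), NE) = f ((i, k), SE)"
      using bspec[OF *, of "((i, k), SW)"] bspec[OF *, of "((i, k), SE)"] i k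
      by (auto simp: ends_iff glue len_def)
  next
    assume *: "?inner \<and> ?outer"
    have inner: "f ((i, k + 1), NW) = f ((i, k), SW)" "f ((i, k + 1), NE) = f ((i, k), SE)"
      if "i < ?m" "k + 1 < len i" for i k
      using * that unfolding len_def by blast+
    have outer: "f ((nx i, 0), NW) = f ((i, 0), NE)"
      "f ((nx i, len (nx i) - 1), SW) = f ((i, len i - 1), SE)" if "i < ?m" for i
      using * that unfolding len_def nx_def by blast+
    have "f (glue ?D ((i, k), c)) = f ((i, k), c)" if i: "i < ?m" and k: "k < len i" for i k c
    proof (cases c)
      case NW
      then show ?thesis
        using outer(1)[OF pv, of i] nx_pv[OF i] inner(1)[OF i, of "k - 1"] k by (auto simp: glue)
    next
      case NE
      then show ?thesis
        using outer(1)[OF i] inner(2)[OF i, of "k - 1"] k by (auto simp: glue)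
    next
      case SW
      show ?thesis
      proof (cases "k + 1 = len i")
        case True
        then have "k = len i - 1" by simp
        with SW show ?thesis using True outer(2)[OF pv, of i] nx_pv[OF i] by (simp add: glue)
      next
        case False
        with SW show ?thesis using inner(1)[OF i, of k] k by (simp add: glue)
      qed
    next
      case SE
      show ?thesis
      proof (cases "k + 1 = len i")
        case True
        then have "k = len i - 1" by simp
        with SE show ?thesis using True outer(2)[OF i] by (simp add: glue)
      next
        case False
        with SE show ?thesis using inner(2)[OF i, of k] k by (simp add: glue)
      qed
    qed
    then show "\<forall>e\<in>ends ?D. f (glue ?D e) = f e" by (auto simp: ends_iff)
  qed
  ultimately show ?thesis using E unfolding fox_colorings_def by blast
qed

text \<open>
  The color forced on an end of a crossing, as an integer before reduction: \<open>a\<close> is the color of the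
  upper left corner of the diagram, and \<open>d j\<close> is the difference of the upper colors of column \<open>j\<close>.
  A right end also collects the difference of its own column, and a lower end is shifted once more
  than the upper ends of the same crossing.
\<close>

definition pretzel_color :: "diagonal \<Rightarrow> int list \<Rightarrow> int \<Rightarrow> (nat \<Rightarrow> int) \<Rightarrow> (nat \<times> nat) \<times> corner \<Rightarrow> int" where
  "pretzel_color pos ps a d = (\<lambda>((i, k), c).
     a + (\<Sum>j < (if c \<in> {NE, SE} then i + 1 else i). d j) +
     column_shift pos (ps ! i) *
       int (if c \<in> {SW, SE} then k + 1 else k) * d i)"

lemma pretzel_color_crossing:
  "pretzel_color pos ps a d ((i, k), SW) = pretzel_color pos ps a d ((i, k), NW) +
     column_shift pos (ps ! i) *
       (pretzel_color pos ps a d ((i, k), NE) - pretzel_color pos ps a d ((i, k), NW))"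
  "pretzel_color pos ps a d ((i, k), SE) = pretzel_color pos ps a d ((i, k), NE) +
     column_shift pos (ps ! i) *
       (pretzel_color pos ps a d ((i, k), NE) - pretzel_color pos ps a d ((i, k), NW))"
  by (simp_all add: pretzel_color_def algebra_simps)

lemma pretzel_color_inner:
  "pretzel_color pos ps a d ((i, k + 1), NW) = pretzel_color pos ps a d ((i, k), SW)"
  "pretzel_color pos ps a d ((i, k + 1), NE) = pretzel_color pos ps a d ((i, k), SE)"
  by (simp_all add: pretzel_color_def)

lemma pretzel_color_top:
  "pretzel_color pos ps a d ((i, 0), NW) = a + sum d {..<i}"
  "pretzel_color pos ps a d ((i, 0), NE) = a + sum d {..<i + 1}"
  by (simp_all add: pretzel_color_def)

lemma pretzel_color_bottom:
  assumes "ps ! i \<noteq> 0"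
  shows "pretzel_color pos ps a d ((i, nat \<bar>ps ! i\<bar> - 1), SW) =
      a + sum d {..<i} + crossing_shift pos * (ps ! i * d i)"
    and "pretzel_color pos ps a d ((i, nat \<bar>ps ! i\<bar> - 1), SE) =
      a + sum d {..<i + 1} + crossing_shift pos * (ps ! i * d i)"
proof -
  have "nat \<bar>ps ! i\<bar> - 1 + 1 = nat \<bar>ps ! i\<bar>" using assms by simp
  then show "pretzel_color pos ps a d ((i, nat \<bar>ps ! i\<bar> - 1), SW) =
      a + sum d {..<i} + crossing_shift pos * (ps ! i * d i)"
    and "pretzel_color pos ps a d ((i, nat \<bar>ps ! i\<bar> - 1), SE) =
      a + sum d {..<i + 1} + crossing_shift pos * (ps ! i * d i)"
    unfolding pretzel_color_def
    by (simp_all only: prod.case insert_iff empty_iff corner.simps simp_thms if_True if_False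
        column_shift_length mult.assoc[symmetric])
qed

lemma cong_crossing:
  fixes x y z :: int
  assumes "[z = w + s * (y - x)] (mod m)" "[w = w'] (mod m)" "[x = x'] (mod m)" "[y = y'] (mod m)"
  shows "[z = w' + s * (y' - x')] (mod m)"
proof -
  have "[w + s * (y - x) = w' + s * (y' - x')] (mod m)"
    using assms by (intro cong_add cong_mult cong_diff) simp_all
  with assms(1) show ?thesis by (rule cong_trans)
qed

text \<open>
  The top row is colored from left to right by adding up the differences; then every column is
  colored from top to bottom, one crossing at a time.
\<close>

lemma fox_coloring_pretzel_color:
  assumes m: "ps \<noteq> []" and nz: "\<forall>q\<in>set ps. q \<noteq> 0"
    and f: "f \<in> fox_colorings n (pretzel pos ps)"
    and a: "[f ((0, 0), NW) = a] (mod int n)"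
    and d: "\<And>i. i < length ps \<Longrightarrow> [f ((i, 0), NE) - f ((i, 0), NW) = d i] (mod int n)"
    and e: "e \<in> ends (pretzel pos ps)"
  shows "[f e = pretzel_color pos ps a d e] (mod int n)"
proof -
  note f' = f[unfolded fox_colorings_pretzel_iff[OF m nz]]
  let ?pc = "pretzel_color pos ps a d"
  have top: "[f ((i, 0), NW) = a + sum d {..<i}] (mod int n)" if "i < length ps" for i
    using that
  proof (induction i)
    case 0 then show ?case using a by simp
  next
    case (Suc i)
    then have "f ((Suc i, 0), NW) = f ((i, 0), NW) + (f ((i, 0), NE) - f ((i, 0), NW))"
      using f' by (metis Suc_eq_plus1 Suc_lessD add.commute diff_add_cancel mod_less)
    moreover have "[f ((i, 0), NW) + (f ((i, 0), NE) - f ((i, 0), NW)) =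
        (a + sum d {..<i}) + d i] (mod int n)"
      using Suc by (intro cong_add d) simp_all
    ultimately show ?case by (simp add: add.assoc)
  qed
  have upper: "[f ((i, k), NW) = ?pc ((i, k), NW)] (mod int n) \<and>
      [f ((i, k), NE) = ?pc ((i, k), NE)] (mod int n)"
    and lower: "[f ((i, k), SW) = ?pc ((i, k), SW)] (mod int n) \<and>
      [f ((i, k), SE) = ?pc ((i, k), SE)] (mod int n)"
    if i: "i < length ps" and k: "k < nat \<bar>ps ! i\<bar>" for i k
  proof -
    have down: "[f ((i, k), SW) = ?pc ((i, k), SW)] (mod int n) \<and>
        [f ((i, k), SE) = ?pc ((i, k), SE)] (mod int n)"
      if k: "k < nat \<bar>ps ! i\<bar>" and NW: "[f ((i, k), NW) = ?pc ((i, k), NW)] (mod int n)"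
        and NE: "[f ((i, k), NE) = ?pc ((i, k), NE)] (mod int n)" for k
    proof -
      have "[f ((i, k), SW) = f ((i, k), NW) +
          column_shift pos (ps ! i) * (f ((i, k), NE) - f ((i, k), NW))] (mod int n)"
        "[f ((i, k), SE) = f ((i, k), NE) +
          column_shift pos (ps ! i) * (f ((i, k), NE) - f ((i, k), NW))] (mod int n)"
        using f' i k by blast+
      from cong_crossing[OF this(1) NW NW NE] cong_crossing[OF this(2) NE NW NE]
      show ?thesis unfolding pretzel_color_crossing ..
    qed
    show up: "[f ((i, k), NW) = ?pc ((i, k), NW)] (mod int n) \<and>
        [f ((i, k), NE) = ?pc ((i, k), NE)] (mod int n)"
      using k
    proof (induction k)
      case 0
      have "[f ((i, 0), NW) + (f ((i, 0), NE) - f ((i, 0), NW)) =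
          (a + sum d {..<i}) + d i] (mod int n)"
        using i by (intro cong_add top d)
      then show ?case using top[OF i] by (simp add: pretzel_color_top add.assoc)
    next
      case (Suc k)
      then have "f ((i, k + 1), NW) = f ((i, k), SW) \<and> f ((i, k + 1), NE) = f ((i, k), SE)"
        using f' i by auto
      moreover have "[f ((i, k), SW) = ?pc ((i, k), SW)] (mod int n) \<and>
          [f ((i, k), SE) = ?pc ((i, k), SE)] (mod int n)"
        using Suc by (intro down) auto
      ultimately show ?case unfolding Suc_eq_plus1 pretzel_color_inner by simp
    qed
    show "[f ((i, k), SW) = ?pc ((i, k), SW)] (mod int n) \<and>
      [f ((i, k), SE) = ?pc ((i, k), SE)] (mod int n)"
      using k up by (intro down) blast+
  qed
  obtain i k c where ikc: "e = ((i, k), c)" by (metis prod.collapse)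
  then have "i < length ps" "k < nat \<bar>ps ! i\<bar>"
    using e by (simp_all add: ends_def pretzel_def)
  with upper lower show ?thesis unfolding ikc by (cases c) blast+
qed

lemma crossing_shift_cancel:
  "[crossing_shift v * x = crossing_shift v * y] (mod m) \<longleftrightarrow> [x = y] (mod m)"
  by (cases v) (simp_all add: crossing_shift_def cong_minus_minus_iff)

text \<open>
  The edge that leads from the last column back to the first one at the top gives the sum condition.
  At the bottom, the edge between adjacent columns joins the right side of one to the left side of
  the next.  These two sides have the same color at the top, so the shifts of the columns agree.
\<close>

lemma fox_coloring_differences_balanced:
  assumes m: "ps \<noteq> []" and nz: "\<forall>q\<in>set ps. q \<noteq> 0"
    and f: "f \<in> fox_colorings n (pretzel pos ps)"
    and d: "\<And>i. i < length ps \<Longrightarrow> [f ((i, 0), NE) - f ((i, 0), NW) = d i] (mod int n)"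
    and dE: "d \<in> {..<length ps} \<rightarrow>\<^sub>E {0..<int n}"
  shows "d \<in> balanced_differences n {..<length ps} (\<lambda>i. ps ! i)"
proof -
  note f' = f[unfolded fox_colorings_pretzel_iff[OF m nz]]
  define a where "a = f ((0, 0), NW)"
  have a: "[f ((0, 0), NW) = a] (mod int n)" by (simp add: a_def)
  have nz_nth: "ps ! i \<noteq> 0" if "i < length ps" for i
    using nz that by simp
  have color: "[f ((i, k), c) = pretzel_color pos ps a d ((i, k), c)] (mod int n)"
    if "i < length ps" "k < nat \<bar>ps ! i\<bar>" for i k c
    by (rule fox_coloring_pretzel_color[OF m nz f a d])
       (use that in \<open>simp_all add: ends_def pretzel_def\<close>)
  have color_top: "[f ((i, 0), c) = pretzel_color pos ps a d ((i, 0), c)] (mod int n)"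
    if "i < length ps" for i c
    using color that nz_nth[OF that] by simp
  have color_bottom: "[f ((i, nat \<bar>ps ! i\<bar> - 1), c) =
      pretzel_color pos ps a d ((i, nat \<bar>ps ! i\<bar> - 1), c)] (mod int n)"
    if "i < length ps" for i c
    using color that nz_nth[OF that] by simp
  have "[(\<Sum>i<length ps. d i) = 0] (mod int n)"
  proof -
    obtain l where l: "length ps = Suc l" using m by (cases ps) auto
    then have "l < length ps" "(l + 1) mod length ps = 0" by simp_all
    with f' have "f ((0, 0), NW) = f ((l, 0), NE)" by metis
    then have "[a = a + sum d {..<length ps}] (mod int n)"
      using color_top[of l NE] by (simp add: a_def pretzel_color_top l)
    then show ?thesis by (simp add: cong_iff_dvd_diff)
  qed
  moreover have "[ps ! i * d i = ps ! 0 * d 0] (mod int n)" if "i < length ps" for i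
    using that
  proof (induction i)
    case (Suc i)
    then have i: "i < length ps" and r: "(i + 1) mod length ps = Suc i" by simp_all
    have "f ((Suc i, nat \<bar>ps ! Suc i\<bar> - 1), SW) = f ((i, nat \<bar>ps ! i\<bar> - 1), SE)"
      using f' i r by metis
    then have "[pretzel_color pos ps a d ((Suc i, nat \<bar>ps ! Suc i\<bar> - 1), SW) =
        pretzel_color pos ps a d ((i, nat \<bar>ps ! i\<bar> - 1), SE)] (mod int n)"
      using color_bottom[OF Suc.prems, of SW] color_bottom[OF i, of SE]
      by (metis cong_sym cong_trans)
    then have "[crossing_shift pos * (ps ! Suc i * d (Suc i)) = crossing_shift pos * (ps ! i * d i)]
        (mod int n)"
      unfolding pretzel_color_bottom[OF nz_nth[OF Suc.prems]] pretzel_color_bottom[OF nz_nth[OF i]]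
      by (simp add: cong_add_lcancel)
    then have "[ps ! Suc i * d (Suc i) = ps ! i * d i] (mod int n)"
      by (simp only: crossing_shift_cancel)
    with Suc.IH[OF i] show ?case by (meson cong_trans)
  qed simp
  then have "[ps ! i * d i = ps ! j * d j] (mod int n)" if "i < length ps" "j < length ps" for i j
    using that by (meson cong_sym cong_trans)
  ultimately show ?thesis using dE unfolding balanced_differences_def by blast
qed

text \<open>
  Crossings and the edges inside the columns are respected for arbitrary \<open>a\<close> and \<open>d\<close>.  The balance
  conditions enter only through the edges between columns: the sum condition at the step from the
  last column to the first, and the equality of the shifts at the bottom.
\<close>

lemma pretzel_color_mem_fox_colorings:
  assumes m: "ps \<noteq> []" and nz: "\<forall>q\<in>set ps. q \<noteq> 0" and n: "n > 0"
    and d: "d \<in> balanced_differences n {..<length ps} (\<lambda>i. ps ! i)"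
  shows "(\<lambda>e\<in>ends (pretzel pos ps). pretzel_color pos ps a d e mod int n)
    \<in> fox_colorings n (pretzel pos ps)"
    (is "?f \<in> _")
proof -
  let ?pc = "pretzel_color pos ps a d" and ?m = "length ps"
  have nz_nth: "ps ! i \<noteq> 0" if "i < ?m" for i
    using nz that by simp
  have ends: "((i, k), c) \<in> ends (pretzel pos ps)" if "i < ?m" "k < nat \<bar>ps ! i\<bar>" for i k c
    using that by (simp add: ends_def pretzel_def)
  have f_cong: "[?f ((i, k), c) = ?pc ((i, k), c)] (mod int n)"
    if "i < ?m" "k < nat \<bar>ps ! i\<bar>" for i k c
    using ends[OF that] by (simp add: cong_def)
  have f_eq: "?f ((i, k), c) = ?f ((i', k'), c')"
    if "[?pc ((i, k), c) = ?pc ((i', k'), c')] (mod int n)"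
      "i < ?m" "k < nat \<bar>ps ! i\<bar>" "i' < ?m" "k' < nat \<bar>ps ! i'\<bar>" for i k c i' k' c'
    using that ends by (simp add: cong_def)
  have sum0: "[sum d {..<?m} = 0] (mod int n)"
    and bal: "\<And>i j. i < ?m \<Longrightarrow> j < ?m \<Longrightarrow> [ps ! i * d i = ps ! j * d j] (mod int n)"
    using d by (auto simp: balanced_differences_def)
  have nx: "(i + 1) mod ?m < ?m" for i using m by simp
  have wrap: "[sum d {..<(i + 1) mod ?m} = sum d {..<i + 1}] (mod int n)" if "i < ?m" for i
  proof (cases "i + 1 = ?m")
    case True then show ?thesis using sum0 by (simp add: cong_sym)
  next
    case False with that show ?thesis by simp
  qed
  show ?thesis
    unfolding fox_colorings_pretzel_iff[OF m nz]
  proof (intro conjI allI impI)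
    show "?f \<in> ends (pretzel pos ps) \<rightarrow>\<^sub>E {0..<int n}" using n by auto
    fix i assume i: "i < ?m"
    {
      fix k assume k: "k < nat \<bar>ps ! i\<bar>"
      note F = f_cong[OF i k] and F' = f_cong[OF i k, THEN cong_sym]
      show "[?f ((i, k), SW) = ?f ((i, k), NW) +
          column_shift pos (ps ! i) * (?f ((i, k), NE) - ?f ((i, k), NW))] (mod int n)"
        by (rule cong_trans[OF F cong_crossing[OF _ F' F' F']])
           (simp only: pretzel_color_crossing cong_refl)
      show "[?f ((i, k), SE) = ?f ((i, k), NE) +
          column_shift pos (ps ! i) * (?f ((i, k), NE) - ?f ((i, k), NW))] (mod int n)"
        by (rule cong_trans[OF F cong_crossing[OF _ F' F' F']])
           (simp only: pretzel_color_crossing cong_refl)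
    next
      fix k assume k: "k + 1 < nat \<bar>ps ! i\<bar>"
      then have k': "k < nat \<bar>ps ! i\<bar>" by simp
      show "?f ((i, k + 1), NW) = ?f ((i, k), SW)"
        by (rule f_eq[OF _ i k i k']) (simp only: pretzel_color_inner cong_refl)
      show "?f ((i, k + 1), NE) = ?f ((i, k), SE)"
        by (rule f_eq[OF _ i k i k']) (simp only: pretzel_color_inner cong_refl)
    next
      show "?f (((i + 1) mod ?m, 0), NW) = ?f ((i, 0), NE)"
      proof (rule f_eq)
        show "[?pc (((i + 1) mod ?m, 0), NW) = ?pc ((i, 0), NE)] (mod int n)"
          unfolding pretzel_color_top by (intro cong_add cong_refl wrap i)
      qed (use i nz_nth nx in \<open>simp_all add: zero_less_nat_eq\<close>)
      show "?f (((i + 1) mod ?m, nat \<bar>ps ! ((i + 1) mod ?m)\<bar> - 1), SW) =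
          ?f ((i, nat \<bar>ps ! i\<bar> - 1), SE)"
      proof (rule f_eq)
        show "[?pc (((i + 1) mod ?m, nat \<bar>ps ! ((i + 1) mod ?m)\<bar> - 1), SW) =
            ?pc ((i, nat \<bar>ps ! i\<bar> - 1), SE)] (mod int n)"
          unfolding pretzel_color_bottom[OF nz_nth[OF nx]] pretzel_color_bottom[OF nz_nth[OF i]]
          by (intro cong_add cong_mult[OF cong_refl] cong_refl wrap bal i nx)
      qed (use i nz_nth nx in \<open>simp_all add: zero_less_nat_eq\<close>)
    }
  qed
qed

text \<open>The factor \<open>n\<close> counts the possible colors of the upper left corner.\<close>

theorem card_fox_colorings_pretzel:
  assumes m: "ps \<noteq> []" and nz: "\<forall>q\<in>set ps. q \<noteq> 0" and n: "n > 0"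
  shows "card (fox_colorings n (pretzel pos ps)) =
    n * card (balanced_differences n {..<length ps} (\<lambda>i. ps ! i))"
proof -
  let ?D = "pretzel pos ps" and ?I = "{..<length ps}"
  let ?B = "balanced_differences n ?I (\<lambda>i. ps ! i)"
  let ?dif = "\<lambda>f. \<lambda>i\<in>?I. (f ((i, 0), NE) - f ((i, 0), NW)) mod int n"
  let ?F = "\<lambda>f. (f ((0, 0), NW), ?dif f)"
  let ?G = "\<lambda>(a, d). \<lambda>e\<in>ends ?D. pretzel_color pos ps a d e mod int n"
  have top: "((i, 0), c) \<in> ends ?D" if "i < length ps" for i c
    using that nz by (simp add: ends_def pretzel_def)
  have dif: "[f ((i, 0), NE) - f ((i, 0), NW) = ?dif f i] (mod int n)" if "i < length ps" for f i
    using that by (simp add: cong_def)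
  have "bij_betw ?F (fox_colorings n ?D) ({0..<int n} \<times> ?B)"
  proof (rule bij_betw_byWitness[where f' = ?G])
    show "\<forall>f\<in>fox_colorings n ?D. ?G (?F f) = f"
    proof
      fix f assume f: "f \<in> fox_colorings n ?D"
      then have fE: "f \<in> ends ?D \<rightarrow>\<^sub>E {0..<int n}" by (simp add: fox_colorings_def)
      show "?G (?F f) = f"
      proof
        fix e show "?G (?F f) e = f e"
        proof (cases "e \<in> ends ?D")
          case True
          have "[f e = pretzel_color pos ps (f ((0, 0), NW)) (?dif f) e] (mod int n)"
            by (rule fox_coloring_pretzel_color[OF m nz f cong_refl dif True])
          moreover have "f e \<in> {0..<int n}" using fE True by (rule PiE_mem)
          ultimately show ?thesis using True by (simp add: cong_def)
        next
          case False then show ?thesis using PiE_arb[OF fE False] by simp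
        qed
      qed
    qed
    show "\<forall>x\<in>{0..<int n} \<times> ?B. ?F (?G x) = x"
    proof
      fix x assume "x \<in> {0..<int n} \<times> ?B"
      then obtain a d where x: "x = (a, d)" and a: "a \<in> {0..<int n}" and d: "d \<in> ?B"
        by blast
      then have dE: "d \<in> ?I \<rightarrow>\<^sub>E {0..<int n}" by (simp add: balanced_differences_def)
      have "?dif (?G (a, d)) = d"
      proof
        fix i show "?dif (?G (a, d)) i = d i"
        proof (cases "i \<in> ?I")
          case True
          then have "d i \<in> {0..<int n}" using dE by blast
          with True show ?thesis by (simp add: top pretzel_color_top mod_simps)
        next
          case False then show ?thesis using PiE_arb[OF dE False] by simp
        qed
      qed
      moreover have "?G (a, d) ((0, 0), NW) = a"
        using a m by (simp add: top pretzel_color_top)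
      ultimately show "?F (?G x) = x" by (simp add: x)
    qed
    show "?F ` fox_colorings n ?D \<subseteq> {0..<int n} \<times> ?B"
    proof (rule image_subsetI)
      fix f assume f: "f \<in> fox_colorings n ?D"
      then have fE: "f \<in> ends ?D \<rightarrow>\<^sub>E {0..<int n}" by (simp add: fox_colorings_def)
      have "f ((0, 0), NW) \<in> {0..<int n}"
        by (rule PiE_mem[OF fE]) (use m in \<open>simp add: top\<close>)
      have dif_E: "?dif f \<in> ?I \<rightarrow>\<^sub>E {0..<int n}"
        by (rule restrict_PiE_iff[THEN iffD2]) (use n in simp)
      have "?dif f \<in> ?B"
        by (rule fox_coloring_differences_balanced[OF m nz f dif dif_E])
      with \<open>f ((0, 0), NW) \<in> {0..<int n}\<close> show "?F f \<in> {0..<int n} \<times> ?B" by simp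
    qed
    show "?G ` ({0..<int n} \<times> ?B) \<subseteq> fox_colorings n ?D"
      using pretzel_color_mem_fox_colorings[OF m nz n] by auto
  qed
  then show ?thesis by (simp add: bij_betw_same_card card_cartesian_product)
qed

section \<open>Counting balanced differences modulo a prime\<close>

text \<open>All values but one can be chosen freely, and the sum condition then determines the last one.\<close>

lemma card_zero_sum_functions:
  assumes "finite Z" "z \<in> Z" "n > 0"
  shows "card {d \<in> Z \<rightarrow>\<^sub>E {0..<int n}. [(\<Sum>i\<in>Z. d i) = 0] (mod int n)} = n ^ (card Z - 1)"
    (is "card ?S = _")
proof -
  let ?Y = "Z - {z}"
  let ?ext = "\<lambda>d. d(z := (- (\<Sum>i\<in>?Y. d i)) mod int n)"
  have split: "(\<Sum>i\<in>Z. d i) = d z + (\<Sum>i\<in>?Y. d i)" for d :: "_ \<Rightarrow> int"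
    using assms by (simp add: sum.remove)
  have ext_sum: "(\<Sum>i\<in>?Y. if i = z then c else d i) = (\<Sum>i\<in>?Y. d i)" for c and d :: "_ \<Rightarrow> int"
    by (rule sum.cong) auto
  have "bij_betw (\<lambda>d. restrict d ?Y) ?S (?Y \<rightarrow>\<^sub>E {0..<int n})"
  proof (rule bij_betw_byWitness[where f' = ?ext])
    show "\<forall>d\<in>?S. ?ext (restrict d ?Y) = d"
    proof
      fix d assume d: "d \<in> ?S"
      then have "[d z = - (\<Sum>i\<in>?Y. d i)] (mod int n)"
        by (simp add: split cong_iff_dvd_diff)
      moreover have "d z \<in> {0..<int n}" using d assms(2) by auto
      ultimately have "(- (\<Sum>i\<in>?Y. d i)) mod int n = d z" by (simp add: cong_def)
      then show "?ext (restrict d ?Y) = d"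
        using d by (auto simp: fun_eq_iff PiE_def extensional_def)
    qed
    show "\<forall>d\<in>?Y \<rightarrow>\<^sub>E {0..<int n}. restrict (?ext d) ?Y = d"
      by (auto simp: fun_eq_iff PiE_def extensional_def)
    show "(\<lambda>d. restrict d ?Y) ` ?S \<subseteq> ?Y \<rightarrow>\<^sub>E {0..<int n}"
    proof (intro image_subsetI restrict_PiE_iff[THEN iffD2] ballI)
      fix d i assume "d \<in> ?S" "i \<in> ?Y"
      then show "d i \<in> {0..<int n}" by (blast dest: PiE_mem)
    qed
    show "?ext ` (?Y \<rightarrow>\<^sub>E {0..<int n}) \<subseteq> ?S"
    proof (intro image_subsetI CollectI conjI)
      fix d assume d: "d \<in> ?Y \<rightarrow>\<^sub>E {0..<int n}"
      show "?ext d \<in> Z \<rightarrow>\<^sub>E {0..<int n}"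
        using d assms by (auto simp: PiE_def extensional_def Pi_def)
      show "[(\<Sum>i\<in>Z. ?ext d i) = 0] (mod int n)"
        by (simp add: split ext_sum cong_def mod_simps)
    qed
  qed
  then have "card ?S = card (?Y \<rightarrow>\<^sub>E {0..<int n})" by (rule bij_betw_same_card)
  then show ?thesis using assms by (simp add: card_PiE)
qed

text \<open>
  The products \<open>q i * d i\<close> all equal \<open>q z * d z = 0\<close>.  So \<open>d i\<close> vanishes wherever \<open>q i\<close> is invertible, and
  is restricted only by the sum condition at the other indices.
\<close>

lemma card_balanced_differences_degenerate:
  assumes n: "prime n" and I: "finite I" and z: "z \<in> I" "int n dvd q z"
  shows "card (balanced_differences n I q) = n ^ (card {i \<in> I. int n dvd q i} - 1)"
proof -
  define Z where "Z = {i \<in> I. int n dvd q i}"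
  let ?S = "{d \<in> Z \<rightarrow>\<^sub>E {0..<int n}. [(\<Sum>i\<in>Z. d i) = 0] (mod int n)}"
  let ?ext = "\<lambda>d. \<lambda>i\<in>I. if i \<in> Z then d i else 0"
  have n0: "n > 0" using n by (rule prime_gt_0_nat)
  have Z: "z \<in> Z" "Z \<subseteq> I" "finite Z" using z I by (auto simp: Z_def)
  have q_Z: "[q i * a = 0] (mod int n)" if "i \<in> Z" for i a
    using that by (simp add: Z_def cong_0_iff)
  have off_Z: "d i = 0" if d: "d \<in> balanced_differences n I q" and i: "i \<in> I - Z" for d i
  proof -
    have "[q i * d i = q z * d z] (mod int n)"
      using d i z by (simp add: balanced_differences_def)
    then have "int n dvd q i * d i"
      using q_Z[OF Z(1)] by (metis cong_0_iff cong_trans)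
    then have "int n dvd d i"
      using i n by (simp add: Z_def prime_dvd_mult_iff)
    moreover have "d i \<in> {0..<int n}"
      using d i by (auto simp: balanced_differences_def)
    ultimately show "d i = 0" using zdvd_imp_le[of "int n" "d i"] by fastforce
  qed
  have sum_Z: "(\<Sum>i\<in>I. d i) = (\<Sum>i\<in>Z. d i)" if "\<And>i. i \<in> I - Z \<Longrightarrow> d i = 0" for d :: "_ \<Rightarrow> int"
    using I Z that by (intro sum.mono_neutral_right) auto
  have "bij_betw (\<lambda>d. restrict d Z) (balanced_differences n I q) ?S"
  proof (rule bij_betw_byWitness[where f' = ?ext])
    show "\<forall>d\<in>balanced_differences n I q. ?ext (restrict d Z) = d"
      using Z off_Z by (auto simp: fun_eq_iff balanced_differences_def PiE_def extensional_def)
    show "\<forall>d\<in>?S. restrict (?ext d) Z = d"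
      using Z by (auto simp: fun_eq_iff PiE_def extensional_def)
    show "(\<lambda>d. restrict d Z) ` balanced_differences n I q \<subseteq> ?S"
    proof (rule image_subsetI)
      fix d assume d: "d \<in> balanced_differences n I q"
      then show "restrict d Z \<in> ?S"
        using Z sum_Z[of d, OF off_Z[OF d]] by (auto simp: balanced_differences_def)
    qed
    show "?ext ` ?S \<subseteq> balanced_differences n I q"
    proof (rule image_subsetI)
      fix d assume d: "d \<in> ?S"
      have "(\<Sum>i\<in>I. ?ext d i) = (\<Sum>i\<in>Z. ?ext d i)" by (rule sum_Z) simp
      also have "\<dots> = (\<Sum>i\<in>Z. d i)" using Z by (intro sum.cong) auto
      finally have "[(\<Sum>i\<in>I. ?ext d i) = 0] (mod int n)" using d by simp
      moreover have "[q i * ?ext d i = 0] (mod int n)" if "i \<in> I" for i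
        using that q_Z by auto
      then have "[q i * ?ext d i = q j * ?ext d j] (mod int n)" if "i \<in> I" "j \<in> I" for i j
        using that by (meson cong_sym cong_trans)
      moreover have "?ext d \<in> I \<rightarrow>\<^sub>E {0..<int n}" using d n0 by auto
      ultimately show "?ext d \<in> balanced_differences n I q"
        unfolding balanced_differences_def by blast
    qed
  qed
  then show ?thesis
    using card_zero_sum_functions[OF Z(3,1) n0] by (simp add: bij_betw_same_card Z_def)
qed

text \<open>
  The solutions of the equations \<open>q i * d i = q j * d j\<close> form a line, spanned by the vector \<open>P\<close> whose
  entry \<open>P i\<close> is the product of all \<open>q j\<close> with \<open>j \<noteq> i\<close>.  The sum condition holds on the whole line if
  the entries of \<open>P\<close> add up to 0, and only at the origin otherwise.
\<close>

lemma card_balanced_differences_nondegenerate: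
  assumes n: "prime n" and I: "finite I" "I \<noteq> {}" and q: "\<And>i. i \<in> I \<Longrightarrow> \<not> int n dvd q i"
  shows "card (balanced_differences n I q) =
    (if [(\<Sum>i\<in>I. \<Prod>j\<in>I - {i}. q j) = 0] (mod int n) then n else 1)"
proof -
  define P where "P i = (\<Prod>j\<in>I - {i}. q j)" for i
  define E where "E = (\<Sum>i\<in>I. P i)"
  let ?K = "{c \<in> {0..<int n}. [c * E = 0] (mod int n)}"
  let ?d = "\<lambda>c. \<lambda>i\<in>I. (c * P i) mod int n"
  have n0: "n > 0" using n by (rule prime_gt_0_nat)
  have np: "prime (int n)" using n by simp
  have cop_q: "coprime (q i) (int n)" if "i \<in> I" for i
    using prime_imp_coprime[OF np q[OF that]] by (simp add: coprime_commute)
  have cop_P: "coprime (P i) (int n)" for i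
    unfolding P_def by (rule prod_coprime_left) (use cop_q in auto)
  have qP: "q i * P i = (\<Prod>j\<in>I. q j)" if "i \<in> I" for i
    using I that by (simp add: P_def prod.remove)
  have d_cong: "[?d c i = c * P i] (mod int n)" if "i \<in> I" for c i
    using that by (simp add: cong_def)
  have sum_d: "[(\<Sum>i\<in>I. ?d c i) = c * E] (mod int n)" for c
    unfolding E_def sum_distrib_left by (intro cong_sum d_cong)
  have "bij_betw ?d ?K (balanced_differences n I q)"
  proof (rule bij_betw_imageI)
    obtain i where i: "i \<in> I" using I by blast
    show "inj_on ?d ?K"
    proof (rule inj_onI)
      fix a b assume ab: "a \<in> ?K" "b \<in> ?K" and eq: "?d a = ?d b"
      have "[a * P i = b * P i] (mod int n)"
        using fun_cong[OF eq, of i] i by (simp add: cong_def)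
      then have "[a = b] (mod int n)" using cop_P by (simp add: cong_mult_rcancel)
      with ab show "a = b" by (simp add: cong_def)
    qed
    show "?d ` ?K = balanced_differences n I q"
    proof (intro equalityI image_subsetI subsetI)
      fix c assume c: "c \<in> ?K"
      have "[q i * ?d c i = c * (\<Prod>j\<in>I. q j)] (mod int n)" if "i \<in> I" for i
        using cong_mult[OF cong_refl d_cong[OF that], of "q i" c] qP[OF that]
        by (simp add: mult.left_commute)
      then have "[q i * ?d c i = q j * ?d c j] (mod int n)" if "i \<in> I" "j \<in> I" for i j
        using that by (meson cong_sym cong_trans)
      moreover have "[(\<Sum>i\<in>I. ?d c i) = 0] (mod int n)"
        using sum_d[of c] c by (metis (no_types, lifting) cong_trans mem_Collect_eq)
      moreover have "?d c \<in> I \<rightarrow>\<^sub>E {0..<int n}" using n0 by auto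
      ultimately show "?d c \<in> balanced_differences n I q"
        unfolding balanced_differences_def by blast
    next
      fix d assume d: "d \<in> balanced_differences n I q"
      then have dE: "d \<in> I \<rightarrow>\<^sub>E {0..<int n}" and d_sum: "[(\<Sum>i\<in>I. d i) = 0] (mod int n)"
        and d_eq: "\<And>i j. i \<in> I \<Longrightarrow> j \<in> I \<Longrightarrow> [q i * d i = q j * d j] (mod int n)"
        by (auto simp: balanced_differences_def)
      \<comment> \<open>The scalar is read off at the index \<open>i\<close>; the equations then fix the other entries.\<close>
      obtain u where u: "[P i * u = 1] (mod int n)"
        using cong_solve_coprime_int[OF cop_P] by blast
      define c where "c = (u * d i) mod int n"
      have "[c = u * d i] (mod int n)" by (simp add: c_def cong_def)
      then have "[c * P i = (u * d i) * P i] (mod int n)" by (rule cong_mult) simp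
      also have "(u * d i) * P i = (P i * u) * d i" by simp
      also have "[\<dots> = 1 * d i] (mod int n)" using u by (rule cong_mult) simp
      finally have c_i: "[c * P i = d i] (mod int n)" by simp
      have c: "[c * P j = d j] (mod int n)" if j: "j \<in> I" for j
      proof -
        have "q j * (c * P j) = q i * (c * P i)"
          using qP[OF i] qP[OF j] by (metis mult.left_commute)
        also have "[\<dots> = q i * d i] (mod int n)" using c_i by (intro cong_mult) simp_all
        also have "[q i * d i = q j * d j] (mod int n)" by (rule d_eq[OF i j])
        finally show ?thesis using cop_q[OF j] by (simp add: cong_mult_lcancel)
      qed
      have d_c: "d = ?d c"
        using dE c by (force simp: fun_eq_iff cong_def PiE_def extensional_def)
      have "[c * E = 0] (mod int n)"
        using d_sum sum_d[of c] unfolding d_c by (meson cong_sym cong_trans)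
      moreover have "c \<in> {0..<int n}" using n0 by (simp add: c_def)
      ultimately show "d \<in> ?d ` ?K" using d_c by blast
    qed
  qed
  then have "card (balanced_differences n I q) = card ?K" by (simp add: bij_betw_same_card)
  also have "card ?K = (if [E = 0] (mod int n) then n else 1)"
  proof (cases "[E = 0] (mod int n)")
    case True
    then have "?K = {0..<int n}" by (auto simp: cong_0_iff)
    with True show ?thesis by simp
  next
    case False
    then have "c = 0" if "c \<in> ?K" for c
      using that np zdvd_imp_le[of "int n" c] by (fastforce simp: cong_0_iff prime_dvd_mult_iff)
    then have "?K = {0}" using n0 by auto
    with False show ?thesis by simp
  qed
  finally show ?thesis by (simp add: E_def P_def)
qed

section \<open>Coloring numbers of pretzel links\<close>

theorem pretzel_dihedral_coloring_number:
  assumes n: "prime n" and m: "ps \<noteq> []" and nz: "\<forall>q\<in>set ps. q \<noteq> 0"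
    and out: "orientation (pretzel pos ps) out"
  defines "I \<equiv> {..<length ps}"
  defines "Z \<equiv> {i \<in> I. int n dvd ps ! i}"
  shows "card (quandle_hom (fundamental_quandle (pretzel pos ps) out) (dihedral_quandle n)) =
    (if Z \<noteq> {} then n ^ card Z
     else if [(\<Sum>i\<in>I. \<Prod>j\<in>I - {i}. ps ! j) = 0] (mod int n) then n ^ 2 else n)"
proof -
  have I: "finite I" "I \<noteq> {}" using m by (auto simp: I_def)
  have "card (quandle_hom (fundamental_quandle (pretzel pos ps) out) (dihedral_quandle n)) =
      n * card (balanced_differences n I (\<lambda>i. ps ! i))"
    using card_quandle_hom_dihedral[OF link_diagram_pretzel[OF nz] out]
      card_fox_colorings_pretzel[OF m nz prime_gt_0_nat[OF n]] by (simp add: I_def)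
  moreover have "n * card (balanced_differences n I (\<lambda>i. ps ! i)) = n ^ card Z" if "Z \<noteq> {}"
  proof -
    from that obtain z where z: "z \<in> I" "int n dvd ps ! z" by (auto simp: Z_def)
    have "card Z > 0" using that I by (simp add: card_gt_0_iff Z_def)
    moreover have "card (balanced_differences n I (\<lambda>i. ps ! i)) = n ^ (card Z - 1)"
      unfolding Z_def
      by (rule card_balanced_differences_degenerate[where q = "\<lambda>i. ps ! i", OF n I(1) z])
    ultimately show ?thesis by (simp flip: power_Suc)
  qed
  moreover have "n * card (balanced_differences n I (\<lambda>i. ps ! i)) =
      (if [(\<Sum>i\<in>I. \<Prod>j\<in>I - {i}. ps ! j) = 0] (mod int n) then n ^ 2 else n)" if "Z = {}"
  proof -
    have "\<not> int n dvd ps ! i" if "i \<in> I" for i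
      using \<open>Z = {}\<close> that by (auto simp: Z_def)
    from card_balanced_differences_nondegenerate[OF n I this] show ?thesis
      by (simp add: power2_eq_square)
  qed
  ultimately show ?thesis by simp
qed

text \<open>
  Here the sum of the products is \<open>h\<close>.  What remains is to read off the case distinction in terms of
  the set \<open>S\<close> of indices \<open>i\<close> with \<open>n dvd p i\<close>.  If \<open>k \<in> S\<close>, then \<open>h\<close> is congruent up to sign to the
  product of the other three \<open>p j\<close>, so \<open>n dvd h\<close> exactly when \<open>S\<close> has a further element.  Thus a nonempty
  \<open>S\<close> has exactly one element if and only if \<open>h\<close> does not vanish, and in that case the count \<open>n ^ card S\<close> is
  \<open>n\<close>, as it is when \<open>S\<close> is empty.
\<close>

theorem corollary26:
  fixes n :: nat and p :: "nat \<Rightarrow> int" and h :: int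
    and pos :: diagonal and out :: "((nat \<times> nat) \<times> corner) set"
    and N :: nat
  assumes "prime n"
    and "\<forall>i\<in>{1..4}. p i > 0"
    and "orientation (pretzel pos [p 1, p 2, - p 3, - p 4]) out"
    and "h = - p 1 * p 2 * p 3 - p 1 * p 2 * p 4 + p 1 * p 3 * p 4 + p 2 * p 3 * p 4"
    and "N = card (quandle_hom (fundamental_quandle (pretzel pos [p 1, p 2, - p 3, - p 4]) out)
                     (dihedral_quandle n))"
  shows "(\<not> [h = 0] (mod int n) \<longrightarrow> N = n)
    \<and> ([h = 0] (mod int n) \<and>
         (\<exists>i\<in>{1..4}. \<exists>j\<in>{1..4}. i \<noteq> j \<and> \<not> [p i * p j = 0] (mod int n)) \<longrightarrow> N = n ^ 2)
    \<and> ((\<exists>!i. i \<in> {1..4} \<and> coprime (p i) (int n)) \<longrightarrow> N = n ^ 3)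
    \<and> ((\<forall>i\<in>{1..4}. [p i = 0] (mod int n)) \<longrightarrow> N = n ^ 4)"
proof -
  let ?ps = "[p 1, p 2, - p 3, - p 4]"
  let ?Z = "{i \<in> {..<length ?ps}. int n dvd ?ps ! i}"
  let ?S = "{i \<in> {1..4}. int n dvd p i}"
  have np: "prime (int n)" using assms(1) by simp
  have index: "i \<in> {1..4} \<longleftrightarrow> i = 1 \<or> i = 2 \<or> i = 3 \<or> i = 4" for i :: nat by auto
  have "p 1 > 0" "p 2 > 0" "p 3 > 0" "p 4 > 0" using assms(2) by auto
  then have nz: "\<forall>q\<in>set ?ps. q \<noteq> 0" by simp
  \<comment> \<open>List positions start from 0, the indices of \<open>p\<close> from 1; signs do not affect divisibility.\<close>
  have "bij_betw Suc ?Z ?S"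
  proof (rule bij_betw_imageI)
    have "i \<in> ?S \<Longrightarrow> i \<in> Suc ` ?Z" for i
      unfolding mem_Collect_eq index
      by (elim conjE disjE) (auto simp: image_iff numeral_eq_Suc less_Suc_eq)
    moreover have "i \<in> ?Z \<Longrightarrow> Suc i \<in> ?S" for i
      by (auto simp: less_Suc_eq numeral_eq_Suc)
    ultimately show "Suc ` ?Z = ?S" by blast
  qed simp
  then have card_Z: "card ?Z = card ?S" by (rule bij_betw_same_card)
  have Z_empty: "?Z = {} \<longleftrightarrow> ?S = {}"
    using \<open>bij_betw Suc ?Z ?S\<close> by (auto simp: bij_betw_def)
  have I: "{..<length ?ps} = {0, 1, 2, 3}" by (auto simp: less_Suc_eq numeral_eq_Suc)
  have E: "(\<Sum>i<length ?ps. \<Prod>j\<in>{..<length ?ps} - {i}. ?ps ! j) = h"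
    unfolding I assms(4) by (simp add: insert_Diff_if algebra_simps numeral_eq_Suc)
  have N: "N = (if ?S \<noteq> {} then n ^ card ?S else if [h = 0] (mod int n) then n ^ 2 else n)"
    using pretzel_dihedral_coloring_number[OF assms(1) _ nz assms(3)]
    unfolding assms(5) E card_Z Z_empty by simp
  have cop: "coprime (p i) (int n) \<longleftrightarrow> i \<notin> ?S" if "i \<in> {1..4}" for i
    using that prime_imp_coprime[OF np, of "p i"] np not_prime_unit
    by (auto simp: coprime_commute[of "p i"] dest: coprime_common_divisor[of "int n" "p i" "int n"])
  have S_sub: "finite ?S" "?S \<subseteq> {1..4}" by auto
  have h_dvd: "int n dvd h \<longleftrightarrow> (\<exists>j\<in>?S. j \<noteq> k)" if k: "k \<in> ?S" for k
  proof -
    have reduce: "int n dvd h \<longleftrightarrow> int n dvd a \<or> int n dvd b \<or> int n dvd c"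
      if "h = p k * w + s * (a * b * c)" "\<bar>s\<bar> = 1" for w a b c s
    proof -
      have "int n dvd h \<longleftrightarrow> int n dvd s * (a * b * c)"
        using k unfolding that(1) by (simp add: dvd_add_right_iff)
      also have "\<dots> \<longleftrightarrow> int n dvd a \<or> int n dvd b \<or> int n dvd c"
        using that(2) np by (auto simp: prime_dvd_mult_iff abs_if split: if_splits)
      finally show ?thesis .
    qed
    have other: "(\<exists>j\<in>?S. j \<noteq> k) \<longleftrightarrow> int n dvd p 1 \<and> 1 \<noteq> k \<or> int n dvd p 2 \<and> 2 \<noteq> k \<or>
        int n dvd p 3 \<and> 3 \<noteq> k \<or> int n dvd p 4 \<and> 4 \<noteq> k"
      (is "?L \<longleftrightarrow> ?R")
    proof
      assume ?L
      then obtain j where j: "j \<noteq> k" "int n dvd p j" and "j \<in> {1..4}" by blast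
      then have "j = 1 \<or> j = 2 \<or> j = 3 \<or> j = 4" by (simp only: index)
      then show ?R using j by (elim disjE) simp_all
    next
      have "(1 :: nat) \<in> {1..4}" "(2 :: nat) \<in> {1..4}" "(3 :: nat) \<in> {1..4}" "(4 :: nat) \<in> {1..4}"
        by simp_all
      moreover assume ?R
      ultimately show ?L by blast
    qed
    have "k = 1 \<or> k = 2 \<or> k = 3 \<or> k = 4" using k index[of k] by blast
    then show ?thesis
    proof (elim disjE)
      assume [simp]: "k = 1"
      have "h = p k * (- p 2 * p 3 - p 2 * p 4 + p 3 * p 4) + 1 * (p 2 * p 3 * p 4)"
        by (simp add: assms(4) algebra_simps)
      from reduce[OF this] show ?thesis unfolding other by simp
    next
      assume [simp]: "k = 2"
      have "h = p k * (- p 1 * p 3 - p 1 * p 4 + p 3 * p 4) + 1 * (p 1 * p 3 * p 4)"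
        by (simp add: assms(4) algebra_simps)
      from reduce[OF this] show ?thesis unfolding other by simp
    next
      assume [simp]: "k = 3"
      have "h = p k * (- p 1 * p 2 + p 1 * p 4 + p 2 * p 4) + - 1 * (p 1 * p 2 * p 4)"
        by (simp add: assms(4) algebra_simps)
      from reduce[OF this] show ?thesis unfolding other by simp
    next
      assume [simp]: "k = 4"
      have "h = p k * (- p 1 * p 2 + p 1 * p 3 + p 2 * p 3) + - 1 * (p 1 * p 2 * p 3)"
        by (simp add: assms(4) algebra_simps)
      from reduce[OF this] show ?thesis unfolding other by simp
    qed
  qed
  have card_S: "card ?S = 1 \<longleftrightarrow> \<not> int n dvd h" if "?S \<noteq> {}"
  proof -
    from that obtain k where k: "k \<in> ?S" by blast
    have "card ?S = 1 \<longleftrightarrow> ?S = {k}"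
    proof
      assume "card ?S = 1"
      then obtain x where "?S = {x}" by (rule card_1_singletonE)
      with k show "?S = {k}" by (simp only: singleton_iff)
    next
      assume "?S = {k}"
      then show "card ?S = 1" by (simp only: card.empty card.insert finite.emptyI empty_iff) simp
    qed
    also have "\<dots> \<longleftrightarrow> \<not> int n dvd h" unfolding h_dvd[OF k] using k by blast
    finally show ?thesis .
  qed
  show ?thesis
  proof (intro conjI impI)
    assume "\<not> [h = 0] (mod int n)"
    then have "\<not> int n dvd h" by (simp add: cong_0_iff)
    with card_S have "card ?S = 1" if "?S \<noteq> {}" using that by blast
    with \<open>\<not> [h = 0] (mod int n)\<close> show "N = n" unfolding N by simp
  next
    assume *: "[h = 0] (mod int n) \<and>
      (\<exists>i\<in>{1..4}. \<exists>j\<in>{1..4}. i \<noteq> j \<and> \<not> [p i * p j = 0] (mod int n))"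
    then obtain i j where ij: "i \<in> {1..4}" "j \<in> {1..4}" "i \<noteq> j" "\<not> int n dvd p i * p j"
      by (auto simp: cong_0_iff)
    then have "?S \<subseteq> {1..4} - {i, j}" by auto
    then have "card ?S \<le> card ({1..4} - {i, j})" by (rule card_mono[rotated]) simp
    also have "\<dots> = 2" using ij by (simp add: card_Diff_subset)
    finally have "card ?S \<le> 2" .
    moreover have "card ?S > 0" if "?S \<noteq> {}" 
      using that S_sub(1) by (rule card_gt_0_iff[THEN iffD2, OF conjI])
    moreover have "card ?S \<noteq> 1" if "?S \<noteq> {}" using card_S[OF that] * by (simp add: cong_0_iff)
    ultimately have "card ?S = 2" if "?S \<noteq> {}" using that by linarith
    with * show "N = n ^ 2" unfolding N by simp
  next
    assume "\<exists>!i. i \<in> {1..4} \<and> coprime (p i) (int n)"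
    then obtain i where i: "i \<in> {1..4}" "coprime (p i) (int n)"
      and unique: "\<And>j. j \<in> {1..4} \<Longrightarrow> coprime (p j) (int n) \<Longrightarrow> j = i" by blast
    have "{1..4} - ?S = {i}"
    proof (intro equalityI subsetI)
      fix j assume "j \<in> {1..4} - ?S"
      then show "j \<in> {i}" using unique[of j] cop[of j] by blast
    next
      fix j assume "j \<in> {i}"
      then show "j \<in> {1..4} - ?S" using i cop[of i] by blast
    qed
    then have "card ({1..4} - ?S) = 1" by simp
    then have "card ?S = 3" using S_sub by (simp add: card_Diff_subset)
    moreover from this have "?S \<noteq> {}" by (metis card.empty zero_neq_numeral)
    ultimately show "N = n ^ 3" unfolding N by (simp only: if_True simp_thms)
  next
    assume "\<forall>i\<in>{1..4}. [p i = 0] (mod int n)"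
    then have "?S = {1..4}" by (auto simp: cong_0_iff)
    then show "N = n ^ 4" unfolding N by simp
  qed
qed

end
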